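(* There exist universal constants $c_0,c_1,d_1>0$ such that the following holds. Let $(\psi_j)_{j\in\Lambda}$ be an orthonormal system of finite size $|\Lambda|=N$ on a domain $\mathcal D$ with orthogonalization measure $\nu$, and let $\omega=(\omega_j)_{j\in\Lambda}$ be weights with $\omega_j\ge\|\psi_j\|_\infty$. Let $s\ge 2\|\omega\|_\infty^2$, let the number of samples $m$ satisfy $$m\ge c_0\, s\log^3(s)\log(N),$$ and let $t_1,\dots,t_m\in\mathcal D$ be drawn i.i.d. from $\nu$. Let $A\in\mathbb C^{m\times N}$ be the sampling matrix, $A_{\ell,j}=\psi_j(t_\ell)$. Then with probability exceeding $1-N^{-\log^3(s)}$ the following holds for all functions $f=\sum_{j\in\Lambda}x_j\psi_j$: given samples $y_\ell=f(t_\ell)$, $\ell=1,\dots,m$, let $x^\sharp$ be the solution of $$\min\|z\|_{\omega,1}\quad\text{subject to}\quad Az=y,$$ and set $f^\sharp=\sum_{j\in\Lambda}x^\sharp_j\psi_j$. Then $$\|f-f^\sharp\|_{L_\infty}\le |\!|\!|f-f^\sharp|\!|\!|_{\omega,1}\le c_1\,\sigma_s(f)_{\omega,1},\qquad \|f-f^\sharp\|_{L_2}\le d_1\,\sigma_s(f)_{\omega,1}/\sqrt s .$$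
   Context: Functions $\psi_j:\mathcal D\to\mathbb C$, $j\in\Lambda$, on a bounded domain $\mathcal D$ form an orthonormal system with orthogonalization measure $\nu$ if $\nu$ is a probability measure on $\mathcal D$ and $\int_{\mathcal D}\psi_j\overline{\psi_k}\,d\nu=\delta_{j,k}$ for all $j,k\in\Lambda$. Here $\|\psi_j\|_\infty$ and $\|\cdot\|_{L_\infty}$ denote the sup norm on $\mathcal D$ and $\|\cdot\|_{L_2}$ is the norm of $L_2(\mathcal D,\nu)$. Weights always satisfy $\omega_j\ge 1$, and $\|\omega\|_\infty=\sup_j\omega_j$. For $x=(x_j)_{j\in\Lambda}$: $\|x\|_{\omega,1}=\sum_{j}\omega_j|x_j|$ and $\|x\|_{\omega,0}=\sum_{j:x_j\ne0}\omega_j^2$. The error of best weighted $s$-term approximation is $\sigma_s(x)_{\omega,1}=\inf\{\|x-z\|_{\omega,1}:\ \|z\|_{\omega,0}\le s\}$. For $f=\sum_{j\in\Lambda}x_j\psi_j$, $|\!|\!|f|\!|\!|_{\omega,1}:=\|x\|_{\omega,1}$ and $\sigma_s(f)_{\omega,1}:=\sigma_s(x)_{\omega,1}$. *)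

theory Defs
  imports "HOL-Probability.Probability"
begin

text \<open>
  A bounded domain in d-dimensional real space, for some finite d. Points are functions
  supported on the first d indices, as in \<open>Euclidean_space\<close>, so that d can be quantified
  inside a formula. Neither openness nor closedness is required: spheres and closed cubes
  are admissible.
\<close>

definition bounded_domain :: "nat \<Rightarrow> (nat \<Rightarrow> real) set \<Rightarrow> bool" where
  "bounded_domain d D \<longleftrightarrow>
     D \<noteq> {} \<and> D \<subseteq> topspace (Euclidean_space d) \<and> (\<exists>B. \<forall>u\<in>D. L2_set u {..<d} \<le> B)"

text \<open>
  No separate integrability clause is needed. A non-integrable function has Bochner integral 0,
  so the case j = k forces every member to be square integrable; the products with
  j different from k are then integrable by Cauchy-Schwarz.
\<close>

definition orthonormal_system ::
    "'i set \<Rightarrow> ('i \<Rightarrow> 'a \<Rightarrow> complex) \<Rightarrow> 'a set \<Rightarrow> 'a measure \<Rightarrow> bool" where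
  "orthonormal_system \<Lambda> \<psi> D \<nu> \<longleftrightarrow>
     prob_space \<nu> \<and> space \<nu> = D \<and>
     (\<forall>j\<in>\<Lambda>. \<psi> j \<in> borel_measurable \<nu>) \<and>
     (\<forall>j\<in>\<Lambda>. \<forall>k\<in>\<Lambda>. (LINT u|\<nu>. \<psi> j u * cnj (\<psi> k u)) = (if j = k then 1 else 0))"

text \<open>Values are extended reals, so an unbounded function has sup norm \<open>\<infinity>\<close>.\<close>

definition sup_norm :: "'a set \<Rightarrow> ('a \<Rightarrow> complex) \<Rightarrow> ennreal" where
  "sup_norm D g = (SUP u\<in>D. ennreal (norm (g u)))"

definition L2_norm :: "'a measure \<Rightarrow> ('a \<Rightarrow> complex) \<Rightarrow> real" where
  "L2_norm \<nu> g = sqrt (LINT u|\<nu>. (norm (g u))\<^sup>2)"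

definition wnorm1 :: "'i set \<Rightarrow> ('i \<Rightarrow> real) \<Rightarrow> ('i \<Rightarrow> complex) \<Rightarrow> real" where
  "wnorm1 \<Lambda> \<omega> x = (\<Sum>j\<in>\<Lambda>. \<omega> j * norm (x j))"

definition wnorm0 :: "'i set \<Rightarrow> ('i \<Rightarrow> real) \<Rightarrow> ('i \<Rightarrow> complex) \<Rightarrow> real" where
  "wnorm0 \<Lambda> \<omega> x = (\<Sum>j\<in>{j\<in>\<Lambda>. x j \<noteq> 0}. (\<omega> j)\<^sup>2)"

definition best_approx_error ::
    "'i set \<Rightarrow> ('i \<Rightarrow> real) \<Rightarrow> real \<Rightarrow> ('i \<Rightarrow> complex) \<Rightarrow> real" where
  "best_approx_error \<Lambda> \<omega> s x =
     (INF z\<in>{z. wnorm0 \<Lambda> \<omega> z \<le> s}. wnorm1 \<Lambda> \<omega> (\<lambda>j. x j - z j))"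

definition expansion ::
    "'i set \<Rightarrow> ('i \<Rightarrow> 'a \<Rightarrow> complex) \<Rightarrow> ('i \<Rightarrow> complex) \<Rightarrow> 'a \<Rightarrow> complex" where
  "expansion \<Lambda> \<psi> x u = (\<Sum>j\<in>\<Lambda>. x j * \<psi> j u)"

definition sampling_matrix ::
    "('i \<Rightarrow> 'a \<Rightarrow> complex) \<Rightarrow> (nat \<Rightarrow> 'a) \<Rightarrow> nat \<Rightarrow> 'i \<Rightarrow> complex" where
  "sampling_matrix \<psi> t l j = \<psi> j (t l)"

definition feasible ::
    "'i set \<Rightarrow> nat \<Rightarrow> (nat \<Rightarrow> 'i \<Rightarrow> complex) \<Rightarrow> (nat \<Rightarrow> complex) \<Rightarrow> ('i \<Rightarrow> complex) \<Rightarrow> bool" where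
  "feasible \<Lambda> m A y z \<longleftrightarrow> (\<forall>l<m. (\<Sum>j\<in>\<Lambda>. A l j * z j) = y l)"

definition wl1_solution ::
    "'i set \<Rightarrow> ('i \<Rightarrow> real) \<Rightarrow> nat \<Rightarrow> (nat \<Rightarrow> 'i \<Rightarrow> complex) \<Rightarrow> (nat \<Rightarrow> complex)
      \<Rightarrow> ('i \<Rightarrow> complex) \<Rightarrow> bool" where
  "wl1_solution \<Lambda> \<omega> m A y z \<longleftrightarrow>
     feasible \<Lambda> m A y z \<and> (\<forall>w. feasible \<Lambda> m A y w \<longrightarrow> wnorm1 \<Lambda> \<omega> z \<le> wnorm1 \<Lambda> \<omega> w)"

end

theory Submission
  imports Defs
begin

text \<open>
  The restricted isometry property is not needed. Put \<open>v = x - xs\<close>, so that \<open>v\<close> lies in the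
  kernel of \<open>A\<close>. It suffices that with high probability every kernel vector satisfies
  \<open>4 sqrt s * \<parallel>v\<parallel>\<^sub>2 \<le> \<parallel>v\<parallel>\<^sub>\<omega>\<^sub>,\<^sub>1\<close>; the standard cone argument then gives \<open>c1 = 4\<close> and \<open>d1 = 1\<close>.

  A kernel vector violating this yields, after splitting coefficients into real and imaginary parts
  of either sign and normalising, a convex combination \<open>h\<close> of at most \<open>4 N\<close> real functions bounded
  by \<open>1\<close> such that \<open>h\<close> has second moment at least \<open>1 / (64 s)\<close> and vanishes at all sample points.
  Then \<open>\<bar>h\<bar> \<ge> 2 \<epsilon>\<close> with probability at least \<open>p\<close>, for some dyadic \<open>\<epsilon>\<close> and \<open>p\<close> of order
  \<open>1 / (s \<epsilon>\<^sup>2)\<close> up to a logarithmic factor. By Maurey's argument an average \<open>g\<close> of \<open>k\<close> of the given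
  functions, \<open>k\<close> of order \<open>ln s / \<epsilon>\<^sup>2\<close>, is within \<open>\<epsilon>\<close> of \<open>h\<close> except on a set of measure at most
  \<open>p / 4\<close> and at most \<open>m p / 4\<close> sample points. So \<open>\<bar>g\<bar> \<ge> \<epsilon>\<close> has probability at least \<open>3 p / 4\<close> but
  occurs at no more than \<open>m p / 4\<close> sample points, an event of probability at most \<open>exp (- m p / 8)\<close>.
  There are at most \<open>(4 N) ^ k\<close> such averages, and \<open>m p\<close> dominates \<open>k ln N\<close>.
\<close>

subsection \<open>Empirical averages of bounded functions\<close>

lemma exp_le_quadratic:
  fixes y :: real
  assumes "\<bar>y\<bar> \<le> 1"
  shows "exp y \<le> 1 + y + y\<^sup>2"
proof (cases "0 \<le> y")
  case True
  then show ?thesis using exp_bound[of y] assms by simp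
next
  case False
  \<comment> \<open>For negative \<open>y\<close> the bound is multiplied by \<open>1 - y\<close>,
    where the product collapses to \<open>1 - y ^ 3\<close>; then
    \<open>1 - y \<le> exp (- y)\<close>.\<close>
  have "1 \<le> (1 + y + y\<^sup>2) * (1 - y)"
  proof -
    have "(1 + y + y\<^sup>2) * (1 - y) = 1 - y ^ 3"
      by (simp add: algebra_simps power2_eq_square power3_eq_cube)
    moreover have "y ^ 3 \<le> 0" using False by (simp add: power_le_zero_eq)
    ultimately show ?thesis by simp
  qed
  also have "\<dots> \<le> (1 + y + y\<^sup>2) * exp (- y)"
  proof (rule mult_left_mono)
    show "1 - y \<le> exp (- y)" using exp_ge_add_one_self[of "-y"] by simp
    have "0 \<le> 1 + y" using assms by simp
    then show "0 \<le> 1 + y + y\<^sup>2" by simp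
  qed
  finally show ?thesis by (simp add: exp_minus field_simps)
qed

lemma sum_prod_weights:
  fixes \<kappa> :: "'j \<Rightarrow> real"
  assumes "finite J"
  shows "(\<Sum>\<tau>\<in>PiE {..<k::nat} (\<lambda>_. J). \<Prod>r<k. \<kappa> (\<tau> r)) = (\<Sum>j\<in>J. \<kappa> j) ^ k"
  using prod_sum_PiE[of "{..<k}" "\<lambda>_. J" "\<lambda>_. \<kappa>"] assms by simp

text \<open>Under the product weights the entries of \<open>\<tau>\<close> are \<open>k\<close>
  independent draws from \<open>\<kappa>\<close>, so the exponential moment factorises into a
  \<open>k\<close>-th power. For one draw the linear term vanishes because \<open>y\<close> is
  centred, and \<open>\<bar>\<theta> * y j\<bar> \<le> 1\<close> admits the quadratic bound on
  \<open>exp\<close>.\<close>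

lemma average_exp_moment:
  fixes \<kappa> y :: "'j \<Rightarrow> real"
  assumes J: "finite J" and \<kappa>: "\<And>j. j \<in> J \<Longrightarrow> 0 \<le> \<kappa> j" "(\<Sum>j\<in>J. \<kappa> j) = 1"
    and y: "\<And>j. j \<in> J \<Longrightarrow> \<bar>y j\<bar> \<le> 2" "(\<Sum>j\<in>J. \<kappa> j * y j) = 0"
    and \<theta>: "\<bar>\<theta>\<bar> \<le> 1 / 2"
  shows "(\<Sum>\<tau>\<in>PiE {..<k::nat} (\<lambda>_. J). (\<Prod>r<k. \<kappa> (\<tau> r)) * exp (\<theta> * (\<Sum>r<k. y (\<tau> r))))
    \<le> exp (4 * \<theta>\<^sup>2 * real k)"
proof -
  have "(\<Sum>\<tau>\<in>PiE {..<k} (\<lambda>_. J). (\<Prod>r<k. \<kappa> (\<tau> r)) * exp (\<theta> * (\<Sum>r<k. y (\<tau> r))))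
     = (\<Sum>\<tau>\<in>PiE {..<k} (\<lambda>_. J). \<Prod>r<k. \<kappa> (\<tau> r) * exp (\<theta> * y (\<tau> r)))"
    by (simp add: sum_distrib_left exp_sum prod.distrib)
  also have "\<dots> = (\<Sum>j\<in>J. \<kappa> j * exp (\<theta> * y j)) ^ k"
    by (rule sum_prod_weights[OF J])
  also have "\<dots> \<le> exp (4 * \<theta>\<^sup>2) ^ k"
  proof (rule power_mono)
    have "(\<Sum>j\<in>J. \<kappa> j * exp (\<theta> * y j)) \<le> (\<Sum>j\<in>J. \<kappa> j * (1 + \<theta> * y j + 4 * \<theta>\<^sup>2))"
    proof (intro sum_mono mult_left_mono)
      fix j assume j: "j \<in> J"
      have "\<bar>\<theta> * y j\<bar> \<le> 1 / 2 * 2"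
        unfolding abs_mult by (intro mult_mono) (use \<theta> y(1)[OF j] in auto)
      then have "exp (\<theta> * y j) \<le> 1 + \<theta> * y j + (\<theta> * y j)\<^sup>2"
        by (intro exp_le_quadratic) simp
      moreover have "(y j)\<^sup>2 \<le> 2\<^sup>2"
        using y(1)[OF j] by (intro abs_le_square_iff[THEN iffD1]) simp
      then have "(\<theta> * y j)\<^sup>2 \<le> 4 * \<theta>\<^sup>2"
        using mult_left_mono[of "(y j)\<^sup>2" 4 "\<theta>\<^sup>2"] by (simp add: power_mult_distrib)
      ultimately show "exp (\<theta> * y j) \<le> 1 + \<theta> * y j + 4 * \<theta>\<^sup>2" by simp
    qed (use \<kappa> in auto)
    also have "\<dots> = (\<Sum>j\<in>J. \<kappa> j) + \<theta> * (\<Sum>j\<in>J. \<kappa> j * y j) + 4 * \<theta>\<^sup>2 * (\<Sum>j\<in>J. \<kappa> j)"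
      by (simp add: algebra_simps sum.distrib sum_distrib_left sum_distrib_right)
    also have "\<dots> \<le> exp (4 * \<theta>\<^sup>2)"
      using \<kappa>(2) y(2) by simp
    finally show "(\<Sum>j\<in>J. \<kappa> j * exp (\<theta> * y j)) \<le> exp (4 * \<theta>\<^sup>2)" .
    show "0 \<le> (\<Sum>j\<in>J. \<kappa> j * exp (\<theta> * y j))" using \<kappa> by (intro sum_nonneg) auto
  qed
  also have "\<dots> = exp (4 * \<theta>\<^sup>2 * real k)"
    by (simp add: exp_of_nat2_mult)
  finally show ?thesis .
qed

text \<open>Chernoff's method with \<open>\<theta>\<close> and \<open>- \<theta>\<close>, one for
  each sign of the deviation, whence the factor \<open>2\<close>. Centring at \<open>\<mu>\<close>
  doubles the range to \<open>2\<close>, the bound assumed in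
  \<open>average_exp_moment\<close>.\<close>

lemma average_tail:
  fixes \<kappa> z :: "'j \<Rightarrow> real"
  assumes J: "finite J" and \<kappa>: "\<And>j. j \<in> J \<Longrightarrow> 0 \<le> \<kappa> j" "(\<Sum>j\<in>J. \<kappa> j) = 1"
    and z: "\<And>j. j \<in> J \<Longrightarrow> \<bar>z j\<bar> \<le> 1" and \<epsilon>: "0 < \<epsilon>" "\<epsilon> \<le> 1" and k: "0 < k"
  defines "\<mu> \<equiv> (\<Sum>j\<in>J. \<kappa> j * z j)"
  shows "(\<Sum>\<tau>\<in>PiE {..<k::nat} (\<lambda>_. J). (\<Prod>r<k. \<kappa> (\<tau> r)) *
            of_bool (\<epsilon> \<le> \<bar>(\<Sum>r<k. z (\<tau> r)) / real k - \<mu>\<bar>))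
    \<le> 2 * exp (- (real k * \<epsilon>\<^sup>2 / 16))"
proof -
  define y where "y j = z j - \<mu>" for j
  \<comment> \<open>This choice minimises
    \<open>4 * \<theta>\<^sup>2 * k - \<theta> * k * \<epsilon>\<close>, with value
    \<open>- (k * \<epsilon>\<^sup>2 / 16)\<close>.\<close>
  define \<theta> where "\<theta> = \<epsilon> / 8"
  have "\<bar>\<mu>\<bar> \<le> (\<Sum>j\<in>J. \<kappa> j * 1)"
    unfolding \<mu>_def
    by (rule order_trans[OF sum_abs]) (intro sum_mono, simp add: abs_mult \<kappa> mult_left_mono z mult_left_le)
  then have \<mu>1: "\<bar>\<mu>\<bar> \<le> 1" using \<kappa> by simp
  have y2: "\<bar>y j\<bar> \<le> 2" if "j \<in> J" for j
    using z[OF that] \<mu>1 by (simp add: y_def)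
  have y0: "(\<Sum>j\<in>J. \<kappa> j * y j) = 0"
    using \<kappa>(2) by (simp add: y_def right_diff_distrib sum_subtractf \<mu>_def flip: sum_distrib_right)
  let ?W = "\<lambda>\<tau>. \<Prod>r<k. \<kappa> (\<tau> r)" and ?Y = "\<lambda>\<tau>. \<Sum>r<k. y (\<tau> r)"
  let ?P = "PiE {..<k} (\<lambda>_. J)"
  have W: "0 \<le> ?W \<tau>" if "\<tau> \<in> ?P" for \<tau>
    using that \<kappa> by (intro prod_nonneg) (auto simp: PiE_iff)
  have "(\<Sum>\<tau>\<in>?P. ?W \<tau> * of_bool (\<epsilon> \<le> \<bar>(\<Sum>r<k. z (\<tau> r)) / real k - \<mu>\<bar>))
      \<le> (\<Sum>\<tau>\<in>?P. ?W \<tau> * (exp (- (\<theta> * real k * \<epsilon>)) * (exp (\<theta> * ?Y \<tau>) + exp (- \<theta> * ?Y \<tau>))))"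
  proof (intro sum_mono mult_left_mono W)
    fix \<tau>
    have eq: "(\<Sum>r<k. z (\<tau> r)) / real k - \<mu> = ?Y \<tau> / real k"
      using k by (simp add: y_def sum_subtractf field_simps)
    have "1 \<le> exp (- (\<theta> * real k * \<epsilon>)) * (exp (\<theta> * ?Y \<tau>) + exp (- \<theta> * ?Y \<tau>))"
      if "\<epsilon> \<le> \<bar>?Y \<tau> / real k\<bar>"
    proof -
      have a: "real k * \<epsilon> \<le> \<bar>?Y \<tau>\<bar>" using that k by (simp add: field_simps)
      have "\<theta> * real k * \<epsilon> \<le> \<theta> * \<bar>?Y \<tau>\<bar>"
        using a \<epsilon> by (simp add: \<theta>_def mult_left_mono)
      then have "exp (\<theta> * real k * \<epsilon>) \<le> exp (\<theta> * \<bar>?Y \<tau>\<bar>)" by simp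
      also have "\<dots> \<le> exp (\<theta> * ?Y \<tau>) + exp (- \<theta> * ?Y \<tau>)"
        by (cases "0 \<le> ?Y \<tau>") (auto simp: abs_if)
      finally show ?thesis by (simp add: exp_minus field_simps)
    qed
    then show "of_bool (\<epsilon> \<le> \<bar>(\<Sum>r<k. z (\<tau> r)) / real k - \<mu>\<bar>)
        \<le> exp (- (\<theta> * real k * \<epsilon>)) * (exp (\<theta> * ?Y \<tau>) + exp (- \<theta> * ?Y \<tau>))"
      unfolding eq by (auto intro!: mult_nonneg_nonneg add_nonneg_nonneg)
  qed
  also have "\<dots> = exp (- (\<theta> * real k * \<epsilon>)) *
      ((\<Sum>\<tau>\<in>?P. ?W \<tau> * exp (\<theta> * ?Y \<tau>)) + (\<Sum>\<tau>\<in>?P. ?W \<tau> * exp (- \<theta> * ?Y \<tau>)))"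
    by (simp add: sum_distrib_left sum.distrib algebra_simps)
  also have "\<dots> \<le> exp (- (\<theta> * real k * \<epsilon>)) * (exp (4 * \<theta>\<^sup>2 * real k) + exp (4 * (- \<theta>)\<^sup>2 * real k))"
    using \<epsilon> by (intro mult_left_mono add_mono average_exp_moment[OF J \<kappa> y2 y0]) (auto simp: \<theta>_def)
  also have "\<dots> = 2 * exp (- (\<theta> * real k * \<epsilon>) + 4 * \<theta>\<^sup>2 * real k)"
    by (simp only: exp_add power2_minus) simp
  also have "- (\<theta> * real k * \<epsilon>) + 4 * \<theta>\<^sup>2 * real k = - (real k * \<epsilon>\<^sup>2 / 16)"
    by (simp add: \<theta>_def power2_eq_square field_simps)
  finally show ?thesis .
qed

section \<open>Lower-tail Chernoff bound and the exceptional event of one level\<close>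

lemma (in prob_space) few_samples_prob:
  assumes G: "G \<in> sets M" and p: "p \<le> prob G"
  shows "measure (PiM {..<m::nat} (\<lambda>_. M))
      {t \<in> space (PiM {..<m} (\<lambda>_. M)). (\<Sum>l<m. indicator G (t l)) \<le> (a::real)}
    \<le> exp (a - real m * p / 2)"
proof -
  let ?P = "PiM {..<m} (\<lambda>_. M)"
  interpret P: product_prob_space "\<lambda>_. M" "{..<m}" by unfold_locales
  interpret PP: finite_product_prob_space "\<lambda>_. M" "{..<m}" by unfold_locales simp
  define B where "B = {t \<in> space ?P. (\<Sum>l<m. indicator G (t l)) \<le> a}"
  have B: "B \<in> sets ?P" unfolding B_def using G by measurable
  have int1: "integrable M (\<lambda>u. exp (- indicator G u :: real))"
    by (rule integrable_const_bound[where B = 1]) (use G in auto)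
  \<comment> \<open>At the two values of the indicator, \<open>exp (- x)\<close> lies below
    \<open>1 - x / 2\<close>. Independence and Markov's inequality for the exponential of minus the
    number of hits then give the tail bound.\<close>
  have "(\<integral>u. exp (- indicator G u :: real) \<partial>M) \<le> (\<integral>u. 1 - indicator G u / 2 \<partial>M)"
  proof (rule integral_mono[OF int1])
    show "integrable M (\<lambda>u. 1 - indicator G u / 2 :: real)"
      using G by (intro Bochner_Integration.integrable_diff integrable_divide) (auto simp: emeasure_eq_measure)
    have "exp (- 1 :: real) \<le> 1 / 2"
      using exp_ge_add_one_self[of 1] by (simp add: exp_minus field_simps)
    then show "exp (- indicator G u :: real) \<le> 1 - indicator G u / 2" for u
      by (auto simp: indicator_def)
  qed
  also have "\<dots> = 1 - prob G / 2"
    using G by (subst Bochner_Integration.integral_diff) (auto simp: emeasure_eq_measure prob_space)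
  also have "\<dots> \<le> 1 + (- p / 2)" using p by simp
  also have "\<dots> \<le> exp (- p / 2)" by (rule exp_ge_add_one_self)
  finally have one: "(\<integral>u. exp (- indicator G u :: real) \<partial>M) \<le> exp (- p / 2)" .
  have int: "integrable ?P (\<lambda>t. \<Prod>l<m. exp (- indicator G (t l) :: real))"
    by (rule P.product_integrable_prod) (use int1 in auto)
  have "measure ?P B = (\<integral>t. indicator B t \<partial>?P)" using B by simp
  also have "\<dots> \<le> (\<integral>t. exp a * (\<Prod>l<m. exp (- indicator G (t l) :: real)) \<partial>?P)"
  proof (rule integral_mono)
    show "integrable ?P (indicator B :: _ \<Rightarrow> real)" using B by (auto simp: P.emeasure_eq_measure)
    show "integrable ?P (\<lambda>t. exp a * (\<Prod>l<m. exp (- indicator G (t l) :: real)))"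
      using int by simp
    fix t
    show "indicator B t \<le> exp a * (\<Prod>l<m. exp (- indicator G (t l) :: real))"
    proof (cases "t \<in> B")
      case True
      have "exp a * (\<Prod>l<m. exp (- indicator G (t l) :: real)) = exp (a - (\<Sum>l<m. indicator G (t l)))"
        by (simp only: exp_sum[OF finite_lessThan, symmetric] exp_add[symmetric] sum_negf) simp
      then show ?thesis using True by (simp add: B_def)
    qed (auto intro!: mult_nonneg_nonneg prod_nonneg)
  qed
  also have "\<dots> = exp a * (\<integral>u. exp (- indicator G u :: real) \<partial>M) ^ m"
    using P.product_integral_prod[of "{..<m}" "\<lambda>_ u. exp (- indicator G u :: real)"] int1 by simp
  also have "\<dots> \<le> exp a * exp (- p / 2) ^ m"
    using one by (intro mult_left_mono power_mono) auto
  also have "\<dots> = exp (a - real m * p / 2)"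
    by (simp add: exp_add[symmetric] flip: exp_of_nat_mult) 
  finally show ?thesis by (simp add: B_def)
qed

text \<open>
  The averages are compared with \<open>h\<close> under the population measure and the empirical measure of the
  sample at once: since the error is small in mean for both, a single average does well for both.
\<close>

lemma (in prob_space) exists_good_average:
  fixes \<kappa> :: "'j \<Rightarrow> real" and \<phi> :: "'j \<Rightarrow> 'a \<Rightarrow> real"
  assumes J: "finite J" and \<kappa>: "\<And>j. j \<in> J \<Longrightarrow> 0 \<le> \<kappa> j" "(\<Sum>j\<in>J. \<kappa> j) = 1"
    and \<phi>: "\<And>j. j \<in> J \<Longrightarrow> \<phi> j \<in> borel_measurable M"
      "\<And>j u. j \<in> J \<Longrightarrow> u \<in> space M \<Longrightarrow> \<bar>\<phi> j u\<bar> \<le> 1"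
    and \<epsilon>: "0 < \<epsilon>" "\<epsilon> \<le> 1" and k: "0 < k" and m: "0 < m"
    and t: "\<And>l. l < m \<Longrightarrow> t l \<in> space M"
  defines "h \<equiv> (\<lambda>u. \<Sum>j\<in>J. \<kappa> j * \<phi> j u)"
    and "g \<equiv> (\<lambda>\<tau> u. (\<Sum>r<k. \<phi> (\<tau> r) u) / real k)"
  assumes p: "p \<le> prob {u \<in> space M. 2 * \<epsilon> \<le> \<bar>h u\<bar>}"
    and q: "2 * exp (- (real k * \<epsilon>\<^sup>2 / 16)) \<le> p / 8"
    and h0: "\<And>l. l < m \<Longrightarrow> h (t l) = 0"
  obtains \<tau> where "\<tau> \<in> PiE {..<k} (\<lambda>_. J)"
    "3 / 4 * p \<le> prob {u \<in> space M. \<epsilon> \<le> \<bar>g \<tau> u\<bar>}"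
    "(\<Sum>l<m. indicator {u \<in> space M. \<epsilon> \<le> \<bar>g \<tau> u\<bar>} (t l)) \<le> real m * p / 4"
proof -
  let ?P = "PiE {..<k} (\<lambda>_. J)" and ?W = "\<lambda>\<tau>. \<Prod>r<k. \<kappa> (\<tau> r)"
  define B where "B \<tau> = {u \<in> space M. \<epsilon> \<le> \<bar>g \<tau> u - h u\<bar>}" for \<tau>
  have gm: "g \<tau> \<in> borel_measurable M" if "\<tau> \<in> ?P" for \<tau>
    unfolding g_def using that \<phi>(1) by (intro borel_measurable_divide borel_measurable_sum) (auto simp: PiE_iff)
  have hm: "h \<in> borel_measurable M"
    unfolding h_def using \<phi>(1) by (intro borel_measurable_sum borel_measurable_times) auto
  have B: "B \<tau> \<in> sets M" if "\<tau> \<in> ?P" for \<tau>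
    unfolding B_def using gm[OF that] hm by measurable
  have W: "0 \<le> ?W \<tau>" if "\<tau> \<in> ?P" for \<tau>
    using that \<kappa> by (intro prod_nonneg) (auto simp: PiE_iff)
  have W1: "(\<Sum>\<tau>\<in>?P. ?W \<tau>) = 1"
    using sum_prod_weights[OF J, of \<kappa> k] \<kappa> by simp
  have tail: "(\<Sum>\<tau>\<in>?P. ?W \<tau> * indicator (B \<tau>) u) \<le> p / 8" if u: "u \<in> space M" for u
  proof -
    have "(\<Sum>\<tau>\<in>?P. ?W \<tau> * indicator (B \<tau>) u)
        = (\<Sum>\<tau>\<in>?P. ?W \<tau> * of_bool (\<epsilon> \<le> \<bar>(\<Sum>r<k. \<phi> (\<tau> r) u) / real k - (\<Sum>j\<in>J. \<kappa> j * \<phi> j u)\<bar>))"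
      using u by (simp add: B_def g_def h_def indicator_def)
    also have "\<dots> \<le> 2 * exp (- (real k * \<epsilon>\<^sup>2 / 16))"
      by (rule average_tail[OF J \<kappa> _ \<epsilon> k]) (use \<phi>(2) u in auto)
    finally show ?thesis using q by simp
  qed
  have "(\<Sum>\<tau>\<in>?P. ?W \<tau> * prob (B \<tau>)) = (\<integral>u. (\<Sum>\<tau>\<in>?P. ?W \<tau> * indicator (B \<tau>) u) \<partial>M)"
    using B by (subst Bochner_Integration.integral_sum) (auto simp: emeasure_eq_measure)
  also have "\<dots> \<le> (\<integral>u. p / 8 \<partial>M)"
    using B tail by (intro integral_mono Bochner_Integration.integrable_sum) (auto simp: emeasure_eq_measure)
  finally have t1: "(\<Sum>\<tau>\<in>?P. ?W \<tau> * prob (B \<tau>)) \<le> p / 8" by (simp add: prob_space)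
  have "(\<Sum>\<tau>\<in>?P. ?W \<tau> * (\<Sum>l<m. indicator (B \<tau>) (t l)))
     = (\<Sum>l<m. \<Sum>\<tau>\<in>?P. ?W \<tau> * indicator (B \<tau>) (t l))"
    by (simp add: sum_distrib_left sum.swap[of _ "?P"])
  also have "\<dots> \<le> (\<Sum>l<m. p / 8)" by (intro sum_mono tail t) auto
  finally have t2: "(\<Sum>\<tau>\<in>?P. ?W \<tau> * (\<Sum>l<m. indicator (B \<tau>) (t l))) \<le> real m * p / 8" by simp
  \<comment> \<open>The population error plus the empirical error has mean at most
    \<open>p / 4\<close>, so some average keeps the sum, hence each summand, within this
    bound.\<close>
  have "\<exists>\<tau>\<in>?P. prob (B \<tau>) + (\<Sum>l<m. indicator (B \<tau>) (t l)) / real m \<le> p / 4"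
  proof (rule ccontr)
    assume "\<not> ?thesis"
    then have neg: "p / 4 < prob (B \<tau>) + (\<Sum>l<m. indicator (B \<tau>) (t l)) / real m" if "\<tau> \<in> ?P" for \<tau>
      using that by auto
    \<comment> \<open>Weights may vanish; strictness of the weighted inequality comes from an
      average of nonzero weight.\<close>
    obtain \<sigma> where \<sigma>: "\<sigma> \<in> ?P" "?W \<sigma> \<noteq> 0"
    proof -
      have "\<not> (\<forall>\<sigma>\<in>?P. ?W \<sigma> = 0)"
        using W1 sum.neutral[of ?P ?W] by linarith
      then show thesis using that by blast
    qed
    have "p / 4 = (\<Sum>\<tau>\<in>?P. ?W \<tau> * (p / 4))" unfolding sum_distrib_right[symmetric] W1 by simp
    also have "\<dots> < (\<Sum>\<tau>\<in>?P. ?W \<tau> * (prob (B \<tau>) + (\<Sum>l<m. indicator (B \<tau>) (t l)) / real m))"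
    proof (rule sum_strict_mono_ex1)
      show "finite ?P" using J by (intro finite_PiE) auto
      show "\<forall>\<tau>\<in>?P. ?W \<tau> * (p / 4) \<le> ?W \<tau> * (prob (B \<tau>) + (\<Sum>l<m. indicator (B \<tau>) (t l)) / real m)"
        using W neg by (intro ballI mult_left_mono) (auto intro: less_imp_le)
      show "\<exists>\<tau>\<in>?P. ?W \<tau> * (p / 4) < ?W \<tau> * (prob (B \<tau>) + (\<Sum>l<m. indicator (B \<tau>) (t l)) / real m)"
        using W[OF \<sigma>(1)] \<sigma> neg[OF \<sigma>(1)] by (intro bexI[of _ \<sigma>] mult_strict_left_mono) auto
    qed
    also have "\<dots> = (\<Sum>\<tau>\<in>?P. ?W \<tau> * prob (B \<tau>)) + (\<Sum>\<tau>\<in>?P. ?W \<tau> * (\<Sum>l<m. indicator (B \<tau>) (t l))) / real m"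
      by (simp add: distrib_left sum.distrib flip: sum_divide_distrib)
    also have "\<dots> \<le> p / 8 + (real m * p / 8) / real m"
      using t1 t2 by (intro add_mono divide_right_mono) auto
    also have "\<dots> = p / 4" using m by simp
    finally show False by simp
  qed
  then obtain \<tau> where \<tau>: "\<tau> \<in> ?P"
    and le: "prob (B \<tau>) + (\<Sum>l<m. indicator (B \<tau>) (t l)) / real m \<le> p / 4" by auto
  define G where "G = {u \<in> space M. \<epsilon> \<le> \<bar>g \<tau> u\<bar>}"
  have G: "G \<in> sets M" unfolding G_def using gm[OF \<tau>] by measurable
  have ind0: "0 \<le> (\<Sum>l<m. indicator (B \<tau>) (t l) :: real)" by (intro sum_nonneg) auto
  \<comment> \<open>Where \<open>\<bar>h u\<bar> \<ge> 2 * \<epsilon>\<close>, either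
    \<open>g \<tau>\<close> differs from \<open>h\<close> by at least \<open>\<epsilon>\<close> or
    \<open>\<bar>g \<tau> u\<bar> \<ge> \<epsilon>\<close>.\<close>
  have "prob {u \<in> space M. 2 * \<epsilon> \<le> \<bar>h u\<bar>} \<le> prob (G \<union> B \<tau>)"
    by (rule finite_measure_mono) (use G B[OF \<tau>] in \<open>auto simp: G_def B_def\<close>)
  also have "\<dots> \<le> prob G + prob (B \<tau>)" by (rule measure_Un_le[OF G B[OF \<tau>]])
  finally have "3 / 4 * p \<le> prob G"
    using p le divide_nonneg_nonneg[OF ind0, of "real m"] by linarith
  moreover have "(\<Sum>l<m. indicator G (t l)) \<le> real m * p / 4"
  proof -
    \<comment> \<open>Since \<open>h\<close> vanishes at the samples, a sample in \<open>G\<close>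
      is one where \<open>g \<tau>\<close> deviates from \<open>h\<close> by at least
      \<open>\<epsilon>\<close>.\<close>
    have "(\<Sum>l<m. indicator G (t l)) \<le> (\<Sum>l<m. indicator (B \<tau>) (t l) :: real)"
      by (intro sum_mono) (use h0 in \<open>auto simp: G_def B_def indicator_def\<close>)
    moreover have "(\<Sum>l<m. indicator (B \<tau>) (t l)) / real m \<le> p / 4"
      using le measure_nonneg[of M "B \<tau>"] by linarith
    ultimately show ?thesis using m by (simp add: field_simps)
  qed
  ultimately show ?thesis using that[OF \<tau>] by (simp add: G_def)
qed

text \<open>One exceptional set has to serve infinitely many \<open>\<kappa>\<close>.
  \<open>exists_good_average\<close> replaces each violating combination by one of at most
  \<open>card J ^ k\<close> averages, a family fixed before sampling, so a union bound over these
  suffices.\<close>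

lemma (in prob_space) level_event:
  fixes \<phi> :: "'j \<Rightarrow> 'a \<Rightarrow> real"
  assumes J: "finite J" and \<phi>: "\<And>j. j \<in> J \<Longrightarrow> \<phi> j \<in> borel_measurable M"
      "\<And>j u. j \<in> J \<Longrightarrow> u \<in> space M \<Longrightarrow> \<bar>\<phi> j u\<bar> \<le> 1"
    and \<epsilon>: "0 < \<epsilon>" "\<epsilon> \<le> 1" and k: "0 < k" and m: "0 < m"
    and q: "2 * exp (- (real k * \<epsilon>\<^sup>2 / 16)) \<le> p / 8"
  obtains B where "B \<in> sets (PiM {..<m} (\<lambda>_. M))"
    "measure (PiM {..<m} (\<lambda>_. M)) B \<le> real (card J) ^ k * exp (- (real m * p / 8))"
    "\<And>t \<kappa>. t \<in> space (PiM {..<m} (\<lambda>_. M)) - B \<Longrightarrow> (\<And>j. j \<in> J \<Longrightarrow> 0 \<le> \<kappa> j) \<Longrightarrow>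
       (\<Sum>j\<in>J. \<kappa> j) = 1 \<Longrightarrow> p \<le> prob {u \<in> space M. 2 * \<epsilon> \<le> \<bar>\<Sum>j\<in>J. \<kappa> j * \<phi> j u\<bar>} \<Longrightarrow>
       \<exists>l<m. (\<Sum>j\<in>J. \<kappa> j * \<phi> j (t l)) \<noteq> 0"
proof -
  let ?Q = "PiM {..<m} (\<lambda>_. M)" and ?P = "PiE {..<k} (\<lambda>_. J)"
  interpret Q: prob_space ?Q by (rule prob_space_PiM) (rule prob_space_axioms)
  define G where "G \<tau> = {u \<in> space M. \<epsilon> \<le> \<bar>(\<Sum>r<k. \<phi> (\<tau> r) u) / real k\<bar>}" for \<tau>
  define T where "T = {\<tau> \<in> ?P. 3 / 4 * p \<le> prob (G \<tau>)}"
  define C where "C \<tau> = {t \<in> space ?Q. (\<Sum>l<m. indicator (G \<tau>) (t l)) \<le> real m * p / 4}" for \<tau>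
  have finP: "finite ?P" using J by (intro finite_PiE) auto
  then have finT: "finite T" by (simp add: T_def)
  have G: "G \<tau> \<in> sets M" if "\<tau> \<in> ?P" for \<tau>
  proof -
    have [measurable]: "(\<lambda>u. (\<Sum>r<k. \<phi> (\<tau> r) u) / real k) \<in> borel_measurable M"
      using that \<phi>(1) by (intro borel_measurable_divide borel_measurable_sum) (auto simp: PiE_iff)
    show ?thesis unfolding G_def by measurable
  qed
  have C: "C \<tau> \<in> sets ?Q" if "\<tau> \<in> T" for \<tau>
  proof -
    have [measurable]: "G \<tau> \<in> sets M" using G that by (simp add: T_def)
    show ?thesis unfolding C_def by measurable
  qed
  have "measure ?Q (\<Union>\<tau>\<in>T. C \<tau>) \<le> (\<Sum>\<tau>\<in>T. measure ?Q (C \<tau>))"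
    using C by (intro Q.finite_measure_subadditive_finite finT) auto
  also have "\<dots> \<le> (\<Sum>\<tau>\<in>T. exp (- (real m * p / 8)))"
  proof (rule sum_mono)
    fix \<tau> assume "\<tau> \<in> T"
    then have "measure ?Q (C \<tau>) \<le> exp (real m * p / 4 - real m * (3 / 4 * p) / 2)"
      unfolding C_def by (intro few_samples_prob G) (auto simp: T_def)
    also have "real m * p / 4 - real m * (3 / 4 * p) / 2 = - (real m * p / 8)"
      by simp
    finally show "measure ?Q (C \<tau>) \<le> exp (- (real m * p / 8))" .
  qed
  also have "\<dots> = real (card T) * exp (- (real m * p / 8))" by simp
  also have "\<dots> \<le> real (card ?P) * exp (- (real m * p / 8))"
    using finP by (intro mult_right_mono) (auto simp: T_def intro: card_mono)
  also have "card ?P = card J ^ k" by (simp add: card_PiE)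
  finally have meas: "measure ?Q (\<Union>\<tau>\<in>T. C \<tau>) \<le> real (card J) ^ k * exp (- (real m * p / 8))" by simp
  show thesis
  proof (rule that[OF _ meas])
    show "(\<Union>\<tau>\<in>T. C \<tau>) \<in> sets ?Q" using C finT by auto
    fix t and \<kappa> :: "'j \<Rightarrow> real"
    assume t: "t \<in> space ?Q - (\<Union>\<tau>\<in>T. C \<tau>)" and \<kappa>: "\<And>j. j \<in> J \<Longrightarrow> 0 \<le> \<kappa> j" "(\<Sum>j\<in>J. \<kappa> j) = 1"
      and p: "p \<le> prob {u \<in> space M. 2 * \<epsilon> \<le> \<bar>\<Sum>j\<in>J. \<kappa> j * \<phi> j u\<bar>}"
    show "\<exists>l<m. (\<Sum>j\<in>J. \<kappa> j * \<phi> j (t l)) \<noteq> 0"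
    proof (rule ccontr)
      assume "\<not> ?thesis"
      then have h0: "(\<Sum>j\<in>J. \<kappa> j * \<phi> j (t l)) = 0" if "l < m" for l using that by auto
      have ts: "t l \<in> space M" if "l < m" for l
        using t that by (auto simp: space_PiM PiE_iff)
      obtain \<tau> where "\<tau> \<in> ?P" "3 / 4 * p \<le> prob (G \<tau>)"
          "(\<Sum>l<m. indicator (G \<tau>) (t l)) \<le> real m * p / 4"
        using exists_good_average[of J \<kappa> \<phi> \<epsilon> k m t p, OF J \<kappa> \<phi> \<epsilon> k m ts p q h0] unfolding G_def by blast
      then have "\<tau> \<in> T" "t \<in> C \<tau>" using t by (auto simp: T_def C_def)
      then show False using t by auto
    qed
  qed
qed

text \<open>
  Plain pigeonholing over the dyadic levels would divide the bound by their number at every level.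
  The summable weights \<open>1 / ((i + 1) (i + 2))\<close> lose only a constant at level \<open>0\<close>, where the
  probability bound \<open>1 - N powr (- (ln s) ^ 3)\<close> is tightest.
\<close>

lemma (in prob_space) second_moment_level:
  fixes h :: "'a \<Rightarrow> real"
  assumes h: "h \<in> borel_measurable M" "\<And>u. u \<in> space M \<Longrightarrow> \<bar>h u\<bar> \<le> 1"
    and S: "1 \<le> S" and moment: "1 / S \<le> (\<integral>u. (h u)\<^sup>2 \<partial>M)"
  obtains i :: nat where "4 ^ i \<le> 2 * S"
    "4 ^ i / (2 * S * (real (i + 1) * real (i + 2))) \<le> prob {u \<in> space M. (1 / 2) ^ (i + 1) \<le> \<bar>h u\<bar>}"
proof -
  \<comment> \<open>On levels outside \<open>I\<close> one has
    \<open>(h u)\<^sup>2 \<le> 1 / (2 * S)\<close>, which accounts for at most half of the required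
    second moment.\<close>
  define I where "I = {i::nat. 4 ^ i \<le> 2 * S}"
  define A where "A i = {u \<in> space M. (1 / 2) ^ (i + 1) \<le> \<bar>h u\<bar>}" for i :: nat
  define p where "p i = 4 ^ i / (2 * S * (real (i + 1) * real (i + 2)))" for i :: nat
  obtain n where n: "2 * S < 4 ^ n" using real_arch_pow[of 4 "2 * S"] by auto
  have In: "I \<subseteq> {..n}"
  proof
    fix i assume "i \<in> I"
    then have "(4::real) ^ i < 4 ^ n" using le_less_trans[OF _ n] unfolding I_def by blast
    then show "i \<in> {..n}" by simp
  qed
  then have finI: "finite I" using finite_subset by blast
  have A [measurable]: "A i \<in> sets M" for i unfolding A_def using h(1) by measurable
  have pt: "(h u)\<^sup>2 \<le> 1 / (2 * S) + (\<Sum>i\<in>I. (1 / 4) ^ i * indicator (A i) u)" if u: "u \<in> space M" for u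
  proof (cases "(h u)\<^sup>2 \<le> 1 / (2 * S)")
    case True
    then show ?thesis by (simp add: add_increasing2 sum_nonneg)
  next
    case False
    then have pos: "0 < \<bar>h u\<bar>" using S by (auto simp: zero_less_abs_iff)
    \<comment> \<open>The dyadic level of \<open>h u\<close>: minimality of \<open>i\<close> gives
      the upper bound \<open>(1 / 2) ^ i\<close>, except at \<open>i = 0\<close>, where
      \<open>\<bar>h u\<bar> \<le> 1\<close> supplies it.\<close>
    define i where "i = (LEAST i. (1 / 2) ^ (i + 1) \<le> \<bar>h u\<bar>)"
    have ex: "\<exists>i::nat. (1 / 2) ^ (i + 1) \<le> \<bar>h u\<bar>"
    proof -
      obtain r where "(1 / 2) ^ r < \<bar>h u\<bar>" using real_arch_pow_inv[OF pos, of "1 / 2"] by auto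
      moreover have "(1 / 2 :: real) ^ (r + 1) \<le> (1 / 2) ^ r" by simp
      ultimately show ?thesis by (intro exI[of _ r]) simp
    qed
    have lo: "(1 / 2) ^ (i + 1) \<le> \<bar>h u\<bar>" unfolding i_def by (rule LeastI_ex[OF ex])
    have hi: "\<bar>h u\<bar> \<le> (1 / 2) ^ i"
    proof (cases i)
      case 0
      then show ?thesis using h(2)[OF u] by simp
    next
      case (Suc r)
      then have "\<not> (1 / 2) ^ (r + 1) \<le> \<bar>h u\<bar>"
        using not_less_Least[of r "\<lambda>i. (1 / 2) ^ (i + 1) \<le> \<bar>h u\<bar>"] by (simp add: i_def)
      then show ?thesis using Suc by simp
    qed
    have sq: "(h u)\<^sup>2 \<le> (1 / 4) ^ i"
    proof -
      have "\<bar>h u\<bar>\<^sup>2 \<le> ((1 / 2) ^ i)\<^sup>2" using hi by (intro power_mono) auto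
      also have "\<dots> = (1 / 4 :: real) ^ i" by (simp add: power2_eq_square flip: power_mult_distrib)
      finally show ?thesis by simp
    qed
    have "1 / (2 * S) < (1 / 4) ^ i" using False sq by simp
    then have iI: "i \<in> I" using S by (simp add: I_def power_divide field_simps)
    have "(h u)\<^sup>2 \<le> (1 / 4) ^ i * indicator (A i) u" using sq lo u by (simp add: A_def)
    also have "\<dots> \<le> (\<Sum>i\<in>I. (1 / 4) ^ i * indicator (A i) u)"
      by (rule member_le_sum[OF iI]) (use finI in auto)
    finally show ?thesis using S by (simp add: add_increasing)
  qed
  have "(\<integral>u. (h u)\<^sup>2 \<partial>M) \<le> (\<integral>u. 1 / (2 * S) + (\<Sum>i\<in>I. (1 / 4) ^ i * indicator (A i) u) \<partial>M)"
  proof (rule integral_mono)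
    show "integrable M (\<lambda>u. (h u)\<^sup>2)"
      using h by (intro integrable_const_bound[where B = 1]) (auto simp: abs_square_le_1)
    show "integrable M (\<lambda>u. 1 / (2 * S) + (\<Sum>i\<in>I. (1 / 4) ^ i * indicator (A i) u))"
      by (intro Bochner_Integration.integrable_add Bochner_Integration.integrable_sum)
        (auto simp: emeasure_eq_measure)
  qed (rule pt)
  also have "\<dots> = 1 / (2 * S) + (\<Sum>i\<in>I. (1 / 4) ^ i * prob (A i))"
    by (subst Bochner_Integration.integral_add)
      (auto simp: emeasure_eq_measure prob_space Bochner_Integration.integral_sum)
  finally have big: "1 / (2 * S) \<le> (\<Sum>i\<in>I. (1 / 4) ^ i * prob (A i))"
    using moment S by (simp add: field_simps)
  \<comment> \<open>If every level fell short, the telescoping sum of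
    \<open>1 / ((i + 1) * (i + 2))\<close>, strictly below \<open>1\<close>, would leave less than
    the remaining half \<open>1 / (2 * S)\<close>.\<close>
  have "\<exists>i\<in>I. p i \<le> prob (A i)"
  proof (rule ccontr)
    assume "\<not> ?thesis"
    then have "(\<Sum>i\<in>I. (1 / 4) ^ i * prob (A i)) \<le> (\<Sum>i\<in>I. (1 / 4) ^ i * p i)"
      by (intro sum_mono mult_left_mono) auto
    also have "\<dots> \<le> (\<Sum>i\<le>n. (1 / 4) ^ i * p i)"
      using In S by (intro sum_mono2) (auto simp: p_def)
    also have "\<dots> = (\<Sum>i\<le>n. 1 / (real (i + 1) * real (i + 2))) / (2 * S)"
      unfolding sum_divide_distrib by (rule sum.cong) (auto simp: p_def power_divide)
    also have "(\<Sum>i\<le>n. 1 / (real (i + 1) * real (i + 2))) = 1 - 1 / real (n + 2)"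
    proof (induction n)
      case (Suc n)
      have "1 / (real (Suc n + 1) * real (Suc n + 2)) = 1 / real (n + 2) - 1 / real (Suc n + 2)"
        by (simp add: field_simps)
      then show ?case using Suc by simp
    qed simp
    also have "\<dots> / (2 * S) < 1 / (2 * S)" using S by (simp add: divide_strict_right_mono)
    finally show False using big by simp
  qed
  then show ?thesis using that by (auto simp: I_def A_def p_def)
qed

subsection \<open>Union bound over levels and averages\<close>

text \<open>Serves to keep the hit probability of every level above a fixed multiple of
  \<open>1 / s\<close>, and to absorb the loss from the level weights into the gain
  \<open>4 ^ i\<close>.\<close>

lemma consecutive_product_le_pow4: "real (i + 1) * real (i + 2) \<le> 2 * 4 ^ i"
proof (induction i)
  case (Suc i)
  have "real (Suc i + 1) * real (Suc i + 2) \<le> 4 * (real (i + 1) * real (i + 2))"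
    by (simp add: algebra_simps)
  also have "\<dots> \<le> 2 * 4 ^ Suc i" using Suc by simp
  finally show ?case .
qed simp

lemma consecutive_product_square_le_pow4: "real (i + 1) * real (i + 2) * real (i + 2) \<le> 5 * 4 ^ i"
proof (induction i)
  case (Suc i)
  show ?case
  \<comment> \<open>Passing from \<open>i\<close> to \<open>i + 1\<close> multiplies the left side
    by at most \<open>4\<close> only for \<open>i \<ge> 1\<close>; the value \<open>18\<close> at
    index \<open>1\<close> forces a constant above \<open>4\<close>.\<close>
  proof (cases "i = 0")
    case False
    then have i: "1 \<le> real i" by simp
    have "(x + 3) * (x + 3) \<le> 4 * ((x + 1) * (x + 2))" if "1 \<le> x" for x :: real
      using that mult_mono[of 1 x 1 x] by (simp add: algebra_simps)
    from this[OF i] have "real (i + 3) * real (i + 3) \<le> 4 * (real (i + 1) * real (i + 2))"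
      by (simp only: of_nat_add of_nat_numeral of_nat_1)
    then have "real (i + 2) * (real (i + 3) * real (i + 3)) \<le> real (i + 2) * (4 * (real (i + 1) * real (i + 2)))"
      by (intro mult_left_mono) auto
    also have "\<dots> = 4 * (real (i + 1) * real (i + 2) * real (i + 2))" by simp
    also have "\<dots> \<le> 5 * 4 ^ Suc i" using Suc by simp
    finally show ?thesis by (simp add: mult.assoc add.commute)
  qed simp
qed simp

text \<open>Up to sign, the terms on the left are the logarithms of the number of averages, of the
  target failure probability and of the geometric weight of level \<open>i\<close>. In the first,
  \<open>i\<close> is of order \<open>ln s\<close>, so \<open>(i + 1) * (i + 2)\<close> costs
  \<open>(ln s)\<^sup>2\<close> beside the factor \<open>ln s\<close> in \<open>k\<close>: this is
  the source of \<open>(ln s) ^ 3\<close>. The other two are absorbed by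
  \<open>4 ^ i\<close>.\<close>

lemma level_numerics:
  fixes s X Y :: real and i :: nat
  assumes s: "2 \<le> s" and i: "4 ^ i \<le> 128 * s" and Y: "ln 2 \<le> Y"
    and k: "real k \<le> 256 * 4 ^ i * ln (4096 * s) + 1"
    and X: "10 ^ 7 * (ln s) ^ 3 * Y \<le> X"
  shows "real k * (3 * Y) + (ln s) ^ 3 * Y + real (i + 2) * ln 2
    \<le> X * 4 ^ i / (real (i + 1) * real (i + 2))"
proof -
  define L where "L = ln s"
  define F :: real where "F = 4 ^ i"
  define d where "d = real (i + 1) * real (i + 2)"
  have l2: "1 / 2 \<le> ln (2 :: real)" using ln2_ge_two_thirds by simp
  have L: "ln 2 \<le> L" using s by (simp add: L_def)
  have L2: "1 / 2 \<le> L" using L l2 by simp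
  have Y2: "1 / 2 \<le> Y" using Y l2 by simp
  have F1: "1 \<le> F" by (simp add: F_def)
  have d2: "2 \<le> d" by (simp add: d_def algebra_simps)
  have dF: "d \<le> 2 * F"
    unfolding d_def F_def by (rule consecutive_product_le_pow4)
  have dF': "d * real (i + 2) \<le> 5 * F"
    unfolding d_def F_def by (rule consecutive_product_square_le_pow4)
  have ln128: "ln (128 * s) = 7 * ln 2 + L"
  proof -
    have "ln (128::real) = ln (2 ^ 7)" by simp
    also have "\<dots> = 7 * ln 2" by (subst ln_realpow) auto
    finally show ?thesis using s by (simp add: ln_mult L_def)
  qed
  have ln4096: "ln (4096 * s) = 12 * ln 2 + L"
  proof -
    have "ln (4096::real) = ln (2 ^ 12)" by simp
    also have "\<dots> = 12 * ln 2" by (subst ln_realpow) auto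
    finally show ?thesis using s by (simp add: ln_mult L_def)
  qed
  have "real i * ln 4 = ln (4 ^ i)" by (subst ln_realpow) auto
  also have "\<dots> \<le> ln (128 * s)" using i s by (subst ln_le_cancel_iff) auto
  also have "\<dots> \<le> 8 * L" using ln128 L by simp
  finally have "real i * ln 4 \<le> 8 * L" .
  moreover have "1 \<le> ln (4::real)"
  proof -
    have "ln (4::real) = ln (2 ^ 2)" by simp
    also have "\<dots> = 2 * ln 2" by (subst ln_realpow) auto
    finally show ?thesis using l2 by simp
  qed
  then have "real i * 1 \<le> real i * ln 4" by (intro mult_left_mono) auto
  ultimately have iL: "real (i + 2) \<le> 12 * L" using L2 by simp
  have dL: "d \<le> 144 * L\<^sup>2"
  proof -
    have "d \<le> (12 * L) * (12 * L)"
      unfolding d_def using iL L2 by (intro mult_mono) auto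
    then show ?thesis by (simp add: power2_eq_square)
  qed
  \<comment> \<open>\<open>12 * ln 2 + L \<le> 13 * L\<close> yields \<open>256 * 13 = 3328\<close>;
    the rounding term \<open>1 \<le> 2 * (F * L)\<close> adds \<open>2\<close>.\<close>
  have kF: "real k \<le> 3330 * (F * L)"
  proof -
    have "256 * F * ln (4096 * s) \<le> 256 * F * (13 * L)"
      using ln4096 L F1 by (intro mult_left_mono) auto
    moreover have "1 * (1 / 2) \<le> F * L" using F1 L2 by (intro mult_mono) auto
    ultimately show ?thesis using k unfolding F_def[symmetric] by simp
  qed
  have L3: "1 / 8 \<le> L ^ 3"
    using power_mono[OF L2, of 3] by (simp add: power_divide)
  have L3Y: "0 \<le> L ^ 3 * Y" using L2 Y2 by simp
  have "d * (real k * (3 * Y)) \<le> (144 * L\<^sup>2) * ((3330 * (F * L)) * (3 * Y))"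
    using dL kF Y2 d2 by (intro mult_mono) auto
  also have "\<dots> = 1438560 * (L ^ 3 * Y * F)"
    by (simp add: power2_eq_square power3_eq_cube)
  finally have A1: "d * (real k * (3 * Y)) \<le> 1438560 * (L ^ 3 * Y * F)" .
  have A2: "d * (L ^ 3 * Y) \<le> 2 * (L ^ 3 * Y * F)"
    using mult_right_mono[OF dF L3Y] by (simp add: algebra_simps)
  have "ln 2 \<le> 8 * (L ^ 3 * Y)"
    using mult_mono[OF L3 Y] L2 by simp
  then have "(d * real (i + 2)) * ln 2 \<le> (5 * F) * (8 * (L ^ 3 * Y))"
    using l2 F1 by (intro mult_mono[OF dF']) auto
  then have A3: "d * (real (i + 2) * ln 2) \<le> 40 * (L ^ 3 * Y * F)"
    by (simp add: algebra_simps)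
  have LYF: "0 \<le> L ^ 3 * Y * F" using mult_nonneg_nonneg[OF L3Y, of F] F1 by simp
  have "d * (real k * (3 * Y) + L ^ 3 * Y + real (i + 2) * ln 2) \<le> 10 ^ 7 * (L ^ 3 * Y * F)"
  proof -
    have "a + b + c \<le> 10 ^ 7 * z" if "a \<le> 1438560 * z" "b \<le> 2 * z" "c \<le> 40 * z" "0 \<le> z"
      for a b c z :: real using that by simp
    from this[OF A1 A2 A3 LYF] show ?thesis unfolding distrib_left .
  qed
  also have "\<dots> = (10 ^ 7 * L ^ 3 * Y) * F" by simp
  also have "\<dots> \<le> X * F" using X F1 unfolding L_def by (intro mult_right_mono) auto
  finally show ?thesis
    using d2 unfolding d_def[symmetric] F_def[symmetric] L_def[symmetric]
    by (simp add: pos_le_divide_eq mult.commute)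
qed

text \<open>\<open>second_moment_level\<close> with \<open>S = 64 * s\<close> puts every combination
  with this second moment on one of finitely many levels, each with its exceptional set from
  \<open>level_event\<close>. The bounds on their measures decay geometrically in the level, so the
  union costs no factor for the number of levels.\<close>

lemma (in prob_space) convex_combinations_not_vanishing:
  fixes \<phi> :: "'j \<Rightarrow> 'a \<Rightarrow> real" and s :: real and N m :: nat
  assumes J: "finite J" "card J \<le> N ^ 3" and N: "2 \<le> N" and \<phi>: "\<And>j. j \<in> J \<Longrightarrow> \<phi> j \<in> borel_measurable M"
      "\<And>j u. j \<in> J \<Longrightarrow> u \<in> space M \<Longrightarrow> \<bar>\<phi> j u\<bar> \<le> 1"
    and s: "2 \<le> s" and m: "10 ^ 11 * s * (ln s) ^ 3 * ln (real N) \<le> real m"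
  obtains B where "B \<in> sets (PiM {..<m} (\<lambda>_. M))"
    "measure (PiM {..<m} (\<lambda>_. M)) B < real N powr (- ((ln s) ^ 3))"
    "\<And>t \<kappa>. t \<in> space (PiM {..<m} (\<lambda>_. M)) - B \<Longrightarrow> (\<And>j. j \<in> J \<Longrightarrow> 0 \<le> \<kappa> j) \<Longrightarrow>
       (\<Sum>j\<in>J. \<kappa> j) = 1 \<Longrightarrow> 1 / (64 * s) \<le> (\<integral>u. (\<Sum>j\<in>J. \<kappa> j * \<phi> j u)\<^sup>2 \<partial>M) \<Longrightarrow>
       \<exists>l<m. (\<Sum>j\<in>J. \<kappa> j * \<phi> j (t l)) \<noteq> 0"
proof -
  let ?Q = "PiM {..<m} (\<lambda>_. M)"
  interpret Q: prob_space ?Q by (rule prob_space_PiM) (rule prob_space_axioms)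
  define Y where "Y = ln (real N)"
  define L where "L = ln s"
  have Y: "ln 2 \<le> Y" using N by (simp add: Y_def)
  have Lpos: "0 < L" using s by (simp add: L_def)
  have Ypos: "0 < Y" using Y ln_gt_zero[of "2::real"] by linarith
  have m0: "0 < m"
  proof (rule ccontr)
    assume "\<not> 0 < m"
    moreover have "0 < 10 ^ 11 * s * L ^ 3 * Y" using s Lpos Ypos by simp
    ultimately show False using m by (simp add: L_def Y_def)
  qed
  define I where "I = {i::nat. 4 ^ i \<le> 128 * s}"
  define p where "p i = 4 ^ i / (2 * (64 * s) * (real (i + 1) * real (i + 2)))" for i :: nat
  \<comment> \<open>Half the threshold of level \<open>i\<close>, leaving the other half for the
    approximation error.\<close>
  define \<epsilon> :: "nat \<Rightarrow> real" where "\<epsilon> i = (1 / 2) ^ (i + 2)" for i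
  \<comment> \<open>Large enough for
    \<open>k i * (\<epsilon> i)\<^sup>2 / 16 \<ge> ln (4096 * s)\<close>; the tail of the averages
    is then at most \<open>1 / (2048 * s)\<close>, an eighth of the lower bound
    \<open>1 / (256 * s)\<close> on \<open>p i\<close>.\<close>
  define k where "k i = nat \<lceil>256 * 4 ^ i * ln (4096 * s)\<rceil>" for i :: nat
  obtain n where n: "128 * s < 4 ^ n" using real_arch_pow[of 4 "128 * s"] by auto
  have In: "I \<subseteq> {..<n}"
  proof
    fix i assume "i \<in> I"
    then have "(4::real) ^ i < 4 ^ n" using le_less_trans[OF _ n] unfolding I_def by blast
    then show "i \<in> {..<n}" by simp
  qed
  then have finI: "finite I" using finite_subset by blast
  have lnpos: "0 < ln (4096 * s)" using s by simp
  have klow: "256 * 4 ^ i * ln (4096 * s) \<le> real (k i)" for i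
    unfolding k_def by (rule real_nat_ceiling_ge)
  have k0: "0 < k i" for i
  proof -
    have "0 < 256 * 4 ^ i * ln (4096 * s)" using lnpos by simp
    then have "0 < real (k i)" using klow[of i] by linarith
    then show ?thesis by simp
  qed
  have khigh: "real (k i) \<le> 256 * 4 ^ i * ln (4096 * s) + 1" for i
  proof -
    have "0 \<le> 256 * 4 ^ i * ln (4096 * s)" using lnpos by simp
    then have "0 \<le> \<lceil>256 * 4 ^ i * ln (4096 * s)\<rceil>" by linarith
    then show ?thesis unfolding k_def by (simp add: of_int_ceiling_le_add_one)
  qed
  have plow: "1 / (256 * s) \<le> p i" for i
  proof -
    have "4 ^ i / (2 * (64 * s) * (2 * 4 ^ i)) \<le> p i"
      unfolding p_def using s consecutive_product_le_pow4[of i]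
      by (intro divide_left_mono mult_left_mono mult_pos_pos) auto
    then show ?thesis using s by (simp add: field_simps)
  qed
  have q: "2 * exp (- (real (k i) * (\<epsilon> i)\<^sup>2 / 16)) \<le> p i / 8" for i
  proof -
    have e2: "(\<epsilon> i)\<^sup>2 = 1 / (16 * 4 ^ i)"
      by (simp add: \<epsilon>_def power2_eq_square power_divide flip: power_mult_distrib)
    have "ln (4096 * s) \<le> real (k i) * (\<epsilon> i)\<^sup>2 / 16"
      unfolding e2 using klow[of i] by (simp add: field_simps)
    then have "exp (- (real (k i) * (\<epsilon> i)\<^sup>2 / 16)) \<le> exp (- ln (4096 * s))" by simp
    also have "\<dots> = 1 / (4096 * s)" using s by (simp add: exp_minus inverse_eq_divide)
    finally show ?thesis using plow[of i] by simp
  qed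
  have \<epsilon>: "0 < \<epsilon> i" "\<epsilon> i \<le> 1" for i
    by (auto simp: \<epsilon>_def power_le_one simp del: power_Suc)
  define good where "good i B \<longleftrightarrow> B \<in> sets ?Q \<and>
    measure ?Q B \<le> real (card J) ^ k i * exp (- (real m * p i / 8)) \<and>
    (\<forall>t \<kappa>. t \<in> space ?Q - B \<longrightarrow> (\<forall>j. j \<in> J \<longrightarrow> 0 \<le> \<kappa> j) \<longrightarrow>
       (\<Sum>j\<in>J. \<kappa> j) = 1 \<longrightarrow> p i \<le> prob {u \<in> space M. 2 * \<epsilon> i \<le> \<bar>\<Sum>j\<in>J. \<kappa> j * \<phi> j u\<bar>} \<longrightarrow>
       (\<exists>l<m. (\<Sum>j\<in>J. \<kappa> j * \<phi> j (t l)) \<noteq> 0))" for i B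
  have "\<forall>i. \<exists>B. good i B"
  proof
    fix i
    show "\<exists>B. good i B"
    proof (rule level_event[of J \<phi> "\<epsilon> i" "k i" m "p i"])
      fix B
      assume B: "B \<in> sets ?Q" "measure ?Q B \<le> real (card J) ^ k i * exp (- (real m * p i / 8))"
        and Bt: "\<And>t \<kappa>. t \<in> space ?Q - B \<Longrightarrow> (\<And>j. j \<in> J \<Longrightarrow> 0 \<le> \<kappa> j) \<Longrightarrow>
          (\<Sum>j\<in>J. \<kappa> j) = 1 \<Longrightarrow> p i \<le> prob {u \<in> space M. 2 * \<epsilon> i \<le> \<bar>\<Sum>j\<in>J. \<kappa> j * \<phi> j u\<bar>} \<Longrightarrow>
          \<exists>l<m. (\<Sum>j\<in>J. \<kappa> j * \<phi> j (t l)) \<noteq> 0"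
      show ?thesis
        unfolding good_def by (intro exI[of _ B] conjI allI impI B Bt) auto
    qed (use J \<phi> \<epsilon> k0 m0 q in auto)
  qed
  then obtain B where good: "\<And>i. good i (B i)"
    unfolding choice_iff by blast
  have B: "B i \<in> sets ?Q"
    and Bm: "measure ?Q (B i) \<le> real (card J) ^ k i * exp (- (real m * p i / 8))" for i
    using good[of i] unfolding good_def by blast+
  have Bt: "\<exists>l<m. (\<Sum>j\<in>J. \<kappa> j * \<phi> j (t l)) \<noteq> 0"
    if "t \<in> space ?Q - B i" "\<And>j. j \<in> J \<Longrightarrow> 0 \<le> \<kappa> j" "(\<Sum>j\<in>J. \<kappa> j) = 1"
      "p i \<le> prob {u \<in> space M. 2 * \<epsilon> i \<le> \<bar>\<Sum>j\<in>J. \<kappa> j * \<phi> j u\<bar>}" for i t \<kappa>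
    using good[of i] that unfolding good_def by blast
  have Bm': "measure ?Q (B i) \<le> exp (- (L ^ 3 * Y)) * (1 / 2) ^ (i + 2)" if i: "i \<in> I" for i
  proof -
    have "real (card J) \<le> real N ^ 3" using J(2) by (simp flip: of_nat_power)
    also have "\<dots> = exp (3 * Y)"
      using N by (simp add: Y_def exp_of_nat_mult[of 3 "ln (real N)", simplified])
    finally have "real (card J) ^ k i \<le> exp (3 * Y) ^ k i" by (intro power_mono) auto
    also have "\<dots> = exp (real (k i) * (3 * Y))" by (simp add: exp_of_nat_mult)
    finally have cJ: "real (card J) ^ k i \<le> exp (real (k i) * (3 * Y))" .
    \<comment> \<open>The right side is \<open>m * p i / 8\<close> written out. The sampling
      constant comes from \<open>10 ^ 7 * 1024 \<le> 10 ^ 11\<close>.\<close>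
    have "real (k i) * (3 * Y) + (ln s) ^ 3 * Y + real (i + 2) * ln 2
      \<le> (real m / (1024 * s)) * 4 ^ i / (real (i + 1) * real (i + 2))"
    proof (rule level_numerics[OF s _ Y khigh])
      show "4 ^ i \<le> 128 * s" using i by (simp add: I_def)
      have "0 \<le> s * L ^ 3 * Y" using s Lpos Ypos by simp
      then have "(10 ^ 7 * 1024) * (s * L ^ 3 * Y) \<le> 10 ^ 11 * (s * L ^ 3 * Y)"
        by (intro mult_right_mono) auto
      then have "10 ^ 7 * L ^ 3 * Y * (1024 * s) \<le> 10 ^ 11 * s * L ^ 3 * Y" by (simp add: mult_ac)
      also have "10 ^ 11 * s * L ^ 3 * Y \<le> real m" using m unfolding L_def Y_def .
      finally show "10 ^ 7 * ln s ^ 3 * Y \<le> real m / (1024 * s)"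
        using s unfolding L_def by (subst pos_le_divide_eq) auto
    qed
    also have "\<dots> = real m * p i / 8" by (simp add: p_def)
    finally have e: "real (k i) * (3 * Y) + L ^ 3 * Y + real (i + 2) * ln 2 \<le> real m * p i / 8"
      by (simp add: L_def)
    have "measure ?Q (B i) \<le> exp (real (k i) * (3 * Y)) * exp (- (real m * p i / 8))"
      using Bm[of i] cJ by (elim order_trans) (intro mult_right_mono, auto)
    also have "\<dots> \<le> exp (- (L ^ 3 * Y) + (- (real (i + 2) * ln 2)))"
      unfolding exp_add[symmetric] using e by simp
    also have "\<dots> = exp (- (L ^ 3 * Y)) * exp (- (real (i + 2) * ln 2))" by (rule exp_add)
    also have "exp (- (real (i + 2) * ln 2)) = inverse ((exp (ln 2)) ^ (i + 2))"
      unfolding exp_minus exp_of_nat_mult ..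
    also have "\<dots> = (1 / 2 :: real) ^ (i + 2)" by (simp add: power_one_over inverse_eq_divide)
    finally show ?thesis .
  qed
  \<comment> \<open>The weights \<open>(1 / 2) ^ (i + 2)\<close> sum to less than
    \<open>1 / 2\<close>, which leaves room for the strict inequality.\<close>
  have meas: "measure ?Q (\<Union>i\<in>I. B i) < real N powr (- ((ln s) ^ 3))"
  proof -
    have "measure ?Q (\<Union>i\<in>I. B i) \<le> (\<Sum>i\<in>I. measure ?Q (B i))"
      using B by (intro Q.finite_measure_subadditive_finite finI) auto
    also have "\<dots> \<le> (\<Sum>i\<in>I. exp (- (L ^ 3 * Y)) * (1 / 2) ^ (i + 2))" by (intro sum_mono Bm')
    also have "\<dots> \<le> (\<Sum>i<n. exp (- (L ^ 3 * Y)) * (1 / 2) ^ (i + 2))"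
      using In by (intro sum_mono2) auto
    also have "\<dots> = exp (- (L ^ 3 * Y)) * (\<Sum>i<n. (1 / 2) ^ (i + 2))" by (simp add: sum_distrib_left)
    also have "(\<Sum>i<n. (1 / 2) ^ (i + 2)) = 1 / 2 - (1 / 2 :: real) ^ (n + 1)"
      by (induction n) auto
    also have "exp (- (L ^ 3 * Y)) * (1 / 2 - (1 / 2 :: real) ^ (n + 1)) < exp (- (L ^ 3 * Y)) * 1"
    proof (rule mult_strict_left_mono)
      have "0 < (1 / 2 :: real) ^ (n + 1)" by simp
      then show "1 / 2 - (1 / 2 :: real) ^ (n + 1) < 1" by linarith
    qed simp
    also have "\<dots> = real N powr (- ((ln s) ^ 3))"
      using N by (simp add: powr_def L_def Y_def)
    finally show ?thesis .
  qed
  show thesis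
  proof (rule that[OF _ meas])
    show "(\<Union>i\<in>I. B i) \<in> sets ?Q" using B finI by auto
    fix t and \<kappa> :: "'j \<Rightarrow> real"
    assume t: "t \<in> space ?Q - (\<Union>i\<in>I. B i)" and \<kappa>: "\<And>j. j \<in> J \<Longrightarrow> 0 \<le> \<kappa> j" "(\<Sum>j\<in>J. \<kappa> j) = 1"
      and mom: "1 / (64 * s) \<le> (\<integral>u. (\<Sum>j\<in>J. \<kappa> j * \<phi> j u)\<^sup>2 \<partial>M)"
    let ?h = "\<lambda>u. \<Sum>j\<in>J. \<kappa> j * \<phi> j u"
    have hm: "?h \<in> borel_measurable M"
      using \<phi>(1) by (intro borel_measurable_sum borel_measurable_times) auto
    have h1: "\<bar>?h u\<bar> \<le> 1" if u: "u \<in> space M" for u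
    proof -
      have "\<bar>?h u\<bar> \<le> (\<Sum>j\<in>J. \<kappa> j * 1)"
        by (rule order_trans[OF sum_abs])
          (intro sum_mono, simp add: abs_mult \<kappa> \<phi>(2)[OF _ u] mult_left_le)
      then show ?thesis using \<kappa> by simp
    qed
    have S1: "1 \<le> 64 * s" using s by simp
    obtain i where i: "4 ^ i \<le> 2 * (64 * s)"
      and pi: "p i \<le> prob {u \<in> space M. (1 / 2) ^ (i + 1) \<le> \<bar>?h u\<bar>}"
      using second_moment_level[OF hm h1 S1 mom] unfolding p_def by blast
    have "2 * \<epsilon> i = (1 / 2) ^ (i + 1)" by (simp add: \<epsilon>_def)
    then have pi': "p i \<le> prob {u \<in> space M. 2 * \<epsilon> i \<le> \<bar>?h u\<bar>}"
      using pi by (simp only:)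
    show "\<exists>l<m. ?h (t l) \<noteq> 0"
      by (rule Bt[OF _ \<kappa> pi']) (use t i in \<open>auto simp: I_def\<close>)
  qed
qed

subsection \<open>Exact recovery from a gap in the kernel\<close>

lemma sup_norm_bound:
  assumes "sup_norm D g \<le> ennreal c" "0 \<le> c" "u \<in> D"
  shows "norm (g u) \<le> c"
proof -
  have "ennreal (norm (g u)) \<le> ennreal c"
    using assms(1,3) unfolding sup_norm_def by (meson SUP_upper order_trans)
  then show ?thesis using assms(2) by simp
qed

lemma norm_expansion_le_wnorm1:
  assumes "\<And>j. j \<in> \<Lambda> \<Longrightarrow> norm (\<psi> j u) \<le> \<omega> j"
  shows "norm (expansion \<Lambda> \<psi> v u) \<le> wnorm1 \<Lambda> \<omega> v"
  unfolding expansion_def wnorm1_def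
  by (intro order_trans[OF norm_sum] sum_mono)
    (simp add: norm_mult assms mult_left_mono mult.commute[of "\<omega> _"])

lemma expansion_diff: "expansion \<Lambda> \<psi> x u - expansion \<Lambda> \<psi> y u = expansion \<Lambda> \<psi> (\<lambda>j. x j - y j) u"
  by (simp add: expansion_def sum_subtractf left_diff_distrib)

text \<open>Parseval's identity: only the diagonal of the double sum survives. The pointwise bounds
  make all products integrable, so the integral passes through the sums.\<close>

lemma orthonormal_L2:
  assumes ons: "orthonormal_system \<Lambda> \<psi> D \<nu>" and fin: "finite \<Lambda>"
    and bd: "\<And>j u. j \<in> \<Lambda> \<Longrightarrow> u \<in> D \<Longrightarrow> norm (\<psi> j u) \<le> \<omega> j"
  shows "(LINT u|\<nu>. (norm (expansion \<Lambda> \<psi> v u))\<^sup>2) = (\<Sum>j\<in>\<Lambda>. (norm (v j))\<^sup>2)"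
proof -
  interpret prob_space \<nu> using ons by (simp add: orthonormal_system_def)
  have m: "\<psi> j \<in> borel_measurable \<nu>" if "j \<in> \<Lambda>" for j
    using ons that by (simp add: orthonormal_system_def)
  have sp: "space \<nu> = D" using ons by (simp add: orthonormal_system_def)
  have int: "integrable \<nu> (\<lambda>u. \<psi> j u * cnj (\<psi> k u))" if "j \<in> \<Lambda>" "k \<in> \<Lambda>" for j k
  proof (rule integrable_const_bound[where B = "\<omega> j * \<omega> k"])
    show "AE u in \<nu>. norm (\<psi> j u * cnj (\<psi> k u)) \<le> \<omega> j * \<omega> k"
    proof (rule AE_I2)
      fix u assume "u \<in> space \<nu>"
      then have "norm (\<psi> j u) \<le> \<omega> j" "norm (\<psi> k u) \<le> \<omega> k" using bd that sp by auto
      then show "norm (\<psi> j u * cnj (\<psi> k u)) \<le> \<omega> j * \<omega> k"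
        by (auto simp: norm_mult intro!: mult_mono elim: order_trans[OF norm_ge_zero])
    qed
    show "(\<lambda>u. \<psi> j u * cnj (\<psi> k u)) \<in> borel_measurable \<nu>"
      by (intro borel_measurable_times m that
          measurable_compose[OF m borel_measurable_continuous_onI[OF continuous_on_cnj]] continuous_on_id)
  qed
  have "complex_of_real (LINT u|\<nu>. (norm (expansion \<Lambda> \<psi> v u))\<^sup>2)
      = (LINT u|\<nu>. complex_of_real ((norm (expansion \<Lambda> \<psi> v u))\<^sup>2))"
    by (rule integral_complex_of_real[symmetric])
  also have "\<dots> = (LINT u|\<nu>. (\<Sum>j\<in>\<Lambda>. \<Sum>k\<in>\<Lambda>. (v j * cnj (v k)) * (\<psi> j u * cnj (\<psi> k u))))"
    by (intro Bochner_Integration.integral_cong refl)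
      (simp only: complex_norm_square expansion_def cnj_sum sum_product complex_cnj_mult mult_ac)
  also have "\<dots> = (\<Sum>j\<in>\<Lambda>. \<Sum>k\<in>\<Lambda>. (v j * cnj (v k)) * (LINT u|\<nu>. \<psi> j u * cnj (\<psi> k u)))"
    using int by (subst Bochner_Integration.integral_sum, force)+ simp
  also have "\<dots> = (\<Sum>j\<in>\<Lambda>. \<Sum>k\<in>\<Lambda>. if j = k then v j * cnj (v k) else 0)"
    using ons by (intro sum.cong refl) (simp add: orthonormal_system_def)
  also have "\<dots> = (\<Sum>j\<in>\<Lambda>. v j * cnj (v j))" using fin by (simp add: sum.delta)
  also have "\<dots> = complex_of_real (\<Sum>j\<in>\<Lambda>. (norm (v j))\<^sup>2)"
    by (simp only: complex_norm_square of_real_sum)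
  finally show ?thesis by (simp only: of_real_eq_iff)
qed

text \<open>
  Combined with Cauchy-Schwarz on a support of weighted size at most \<open>s\<close>, this gives the weighted
  null space property of order \<open>s\<close> with constant \<open>1 / 3\<close>.
\<close>

definition kernel_gap :: "'i set \<Rightarrow> ('i \<Rightarrow> 'a \<Rightarrow> complex) \<Rightarrow> ('i \<Rightarrow> real) \<Rightarrow> real \<Rightarrow> nat \<Rightarrow> (nat \<Rightarrow> 'a) \<Rightarrow> bool" where
  "kernel_gap \<Lambda> \<psi> \<omega> s m t \<longleftrightarrow>
     (\<forall>v. (\<forall>l<m. expansion \<Lambda> \<psi> v (t l) = 0) \<longrightarrow>
        4 * sqrt s * sqrt (\<Sum>j\<in>\<Lambda>. (norm (v j))\<^sup>2) \<le> wnorm1 \<Lambda> \<omega> v)"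

text \<open>Let \<open>S\<close> be the support of a competitor \<open>z\<close>. Minimality bounds
  \<open>v\<close> off \<open>S\<close> by \<open>v\<close> on \<open>S\<close> plus twice
  \<open>x\<close> off \<open>S\<close>; the gap and Cauchy-Schwarz bound \<open>v\<close> on
  \<open>S\<close> by a quarter of the whole. Hence the weighted norm of \<open>v\<close> is at most
  four times that of \<open>x\<close> off \<open>S\<close>, where \<open>x\<close> and
  \<open>x - z\<close> agree.\<close>

lemma wl1_minimizer_error:
  assumes fin: "finite \<Lambda>" and \<omega>: "\<And>j. j \<in> \<Lambda> \<Longrightarrow> 0 \<le> \<omega> j" and s: "0 < s"
    and gap: "kernel_gap \<Lambda> \<psi> \<omega> s m t"
    and sol: "wl1_solution \<Lambda> \<omega> m (sampling_matrix \<psi> t) (\<lambda>l. expansion \<Lambda> \<psi> x (t l)) xs"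
  defines "v \<equiv> (\<lambda>j. x j - xs j)"
  shows "wnorm1 \<Lambda> \<omega> v \<le> 4 * best_approx_error \<Lambda> \<omega> s x"
    and "sqrt (\<Sum>j\<in>\<Lambda>. (norm (v j))\<^sup>2) \<le> best_approx_error \<Lambda> \<omega> s x / sqrt s"
proof -
  let ?n2 = "sqrt (\<Sum>j\<in>\<Lambda>. (norm (v j))\<^sup>2)"
  have feas: "feasible \<Lambda> m (sampling_matrix \<psi> t) (\<lambda>l. expansion \<Lambda> \<psi> x (t l)) xs"
    and min: "feasible \<Lambda> m (sampling_matrix \<psi> t) (\<lambda>l. expansion \<Lambda> \<psi> x (t l)) w \<Longrightarrow>
      wnorm1 \<Lambda> \<omega> xs \<le> wnorm1 \<Lambda> \<omega> w" for w
    using sol by (auto simp: wl1_solution_def)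
  have "expansion \<Lambda> \<psi> v (t l) = 0" if "l < m" for l
    using feas that unfolding v_def expansion_diff[symmetric]
    by (simp add: feasible_def sampling_matrix_def expansion_def mult.commute)
  then have gap: "4 * sqrt s * ?n2 \<le> wnorm1 \<Lambda> \<omega> v"
    using gap by (simp add: kernel_gap_def)
  have le: "wnorm1 \<Lambda> \<omega> xs \<le> wnorm1 \<Lambda> \<omega> x"
    by (rule min) (simp add: feasible_def sampling_matrix_def expansion_def mult.commute)
  have "wnorm1 \<Lambda> \<omega> v / 4 \<le> best_approx_error \<Lambda> \<omega> s x"
    unfolding best_approx_error_def
  proof (rule cINF_greatest)
    have "(\<lambda>_. 0) \<in> {z. wnorm0 \<Lambda> \<omega> z \<le> s}" using s by (simp add: wnorm0_def)
    then show "{z. wnorm0 \<Lambda> \<omega> z \<le> s} \<noteq> {}" by blast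
    fix z assume "z \<in> {z. wnorm0 \<Lambda> \<omega> z \<le> s}"
    then have z: "wnorm0 \<Lambda> \<omega> z \<le> s" by simp
    define S where "S = {j \<in> \<Lambda>. z j \<noteq> 0}"
    have S: "S \<subseteq> \<Lambda>" "finite S" using fin by (auto simp: S_def)
    have split: "wnorm1 \<Lambda> \<omega> w = wnorm1 S \<omega> w + wnorm1 (\<Lambda> - S) \<omega> w" for w :: "'a \<Rightarrow> complex"
      unfolding wnorm1_def using sum.subset_diff[OF S(1) fin] by (simp add: add.commute)
    have "wnorm1 S \<omega> x - wnorm1 S \<omega> v \<le> wnorm1 S \<omega> xs"
      unfolding wnorm1_def sum_subtractf[symmetric]
    proof (rule sum_mono)
      fix j assume "j \<in> S"
      then have "0 \<le> \<omega> j" using \<omega>[of j] S by auto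
      moreover have "norm (x j) - norm (v j) \<le> norm (xs j)"
        using norm_triangle_ineq2[of "x j" "v j"] by (simp add: v_def)
      ultimately show "\<omega> j * norm (x j) - \<omega> j * norm (v j) \<le> \<omega> j * norm (xs j)"
        by (simp add: mult_left_mono flip: right_diff_distrib)
    qed
    moreover have "wnorm1 (\<Lambda> - S) \<omega> v - wnorm1 (\<Lambda> - S) \<omega> x \<le> wnorm1 (\<Lambda> - S) \<omega> xs"
      unfolding wnorm1_def sum_subtractf[symmetric]
    proof (rule sum_mono)
      fix j assume "j \<in> \<Lambda> - S"
      then have "0 \<le> \<omega> j" using \<omega>[of j] by auto
      moreover have "norm (v j) - norm (x j) \<le> norm (xs j)"
        using norm_triangle_ineq4[of "x j" "xs j"] by (simp add: v_def)
      ultimately show "\<omega> j * norm (v j) - \<omega> j * norm (x j) \<le> \<omega> j * norm (xs j)"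
        by (simp add: mult_left_mono flip: right_diff_distrib)
    qed
    ultimately have cone: "wnorm1 (\<Lambda> - S) \<omega> v \<le> wnorm1 S \<omega> v + 2 * wnorm1 (\<Lambda> - S) \<omega> x"
      using le split[of x] split[of xs] by linarith
    \<comment> \<open>Cauchy-Schwarz separates weights from coefficients;
      \<open>wnorm0 \<Lambda> \<omega> z \<le> s\<close> says that the weights on \<open>S\<close>
      have Euclidean norm at most \<open>sqrt s\<close>.\<close>
    have "wnorm1 S \<omega> v \<le> L2_set \<omega> S * L2_set (\<lambda>j. norm (v j)) S"
      unfolding wnorm1_def
      by (rule order_trans[OF _ L2_set_mult_ineq]) (intro sum_mono, simp add: abs_mult abs_ge_self mult_right_mono)
    also have "\<dots> \<le> sqrt s * ?n2"
    proof (rule mult_mono)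
      show "L2_set \<omega> S \<le> sqrt s" using z by (simp add: L2_set_def wnorm0_def S_def)
      show "L2_set (\<lambda>j. norm (v j)) S \<le> ?n2"
        unfolding L2_set_def by (intro real_sqrt_le_mono sum_mono2 fin S) auto
    qed (use s in \<open>auto simp: L2_set_nonneg\<close>)
    finally have "4 * wnorm1 S \<omega> v \<le> wnorm1 \<Lambda> \<omega> v" using gap by simp
    with cone split[of v] have "wnorm1 \<Lambda> \<omega> v / 4 \<le> wnorm1 (\<Lambda> - S) \<omega> x" by linarith
    also have "\<dots> = wnorm1 (\<Lambda> - S) \<omega> (\<lambda>j. x j - z j)"
      unfolding wnorm1_def by (rule sum.cong) (auto simp: S_def)
    also have "\<dots> \<le> wnorm1 \<Lambda> \<omega> (\<lambda>j. x j - z j)"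
    proof -
      have "0 \<le> wnorm1 S \<omega> (\<lambda>j. x j - z j)"
        unfolding wnorm1_def using \<omega> S by (intro sum_nonneg mult_nonneg_nonneg) force+
      then show ?thesis using split by simp
    qed
    finally show "wnorm1 \<Lambda> \<omega> v / 4 \<le> wnorm1 \<Lambda> \<omega> (\<lambda>j. x j - z j)" .
  qed
  then show 1: "wnorm1 \<Lambda> \<omega> v \<le> 4 * best_approx_error \<Lambda> \<omega> s x" by simp
  \<comment> \<open>The factor \<open>4\<close> of the gap cancels the \<open>4\<close> of the
    weighted error bound, leaving the constant \<open>1\<close>.\<close>
  have "sqrt s * ?n2 \<le> best_approx_error \<Lambda> \<omega> s x" using gap 1 by simp
  then show "?n2 \<le> best_approx_error \<Lambda> \<omega> s x / sqrt s"
    using s by (simp add: pos_le_divide_eq mult.commute)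
qed

section \<open>Reduction of complex expansions to real convex combinations\<close>

definition quarter_turns :: "complex set" where
  "quarter_turns = {1, -1, \<i>, -\<i>}"

lemma sum_quarter_turns: "(\<Sum>c\<in>quarter_turns. f c) = f 1 + f (-1) + f \<i> + f (-\<i>)"
  for f :: "complex \<Rightarrow> 'b::comm_monoid_add"
  by (simp add: quarter_turns_def complex_eq_iff add.assoc)

lemma card_quarter_turns: "finite quarter_turns" "card quarter_turns = 4"
  by (simp_all add: quarter_turns_def complex_eq_iff)

lemma norm_quarter_turn: "c \<in> quarter_turns \<Longrightarrow> norm c = 1"
  by (auto simp: quarter_turns_def)

text \<open>The weights are the positive and negative parts of \<open>Re z\<close> and
  \<open>Im z\<close>, and \<open>z\<close> is the sum of the directions \<open>c\<close> with these
  weights. Complex coefficients thus become nonnegative ones on real functions.\<close>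

lemma sum_quarter_turns_decomposition:
  "(\<Sum>c\<in>quarter_turns. max 0 (Re (z * cnj c)) * Re (c * w)) = Re (z * w)"
  "(\<Sum>c\<in>quarter_turns. max 0 (Re (z * cnj c))) = \<bar>Re z\<bar> + \<bar>Im z\<bar>"
  by (auto simp: sum_quarter_turns max_def)

text \<open>For a kernel vector with \<open>W v \<noteq> 0\<close>, the real part of the expansion
  divided by \<open>W v\<close> is a convex combination of the \<open>\<phi>\<close> vanishing at
  the samples, so its second moment is below \<open>1 / (64 * s)\<close>. A rotation handles the
  imaginary part, and Parseval turns both into a bound on the coefficients.\<close>

lemma kernel_gap_event:
  fixes \<Lambda> :: "'i set" and \<psi> :: "'i \<Rightarrow> 'a \<Rightarrow> complex"
  assumes ons: "orthonormal_system \<Lambda> \<psi> D \<nu>" and fin: "finite \<Lambda>" and N: "card \<Lambda> = N" "2 \<le> N"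
    and \<omega>: "\<And>j. j \<in> \<Lambda> \<Longrightarrow> 1 \<le> \<omega> j"
    and bd: "\<And>j u. j \<in> \<Lambda> \<Longrightarrow> u \<in> D \<Longrightarrow> norm (\<psi> j u) \<le> \<omega> j"
    and s: "2 \<le> s" and m: "10 ^ 11 * s * (ln s) ^ 3 * ln (real N) \<le> real m"
  obtains E where "E \<in> sets (PiM {..<m} (\<lambda>_. \<nu>))"
    "1 - real N powr (- ((ln s) ^ 3)) < measure (PiM {..<m} (\<lambda>_. \<nu>)) E"
    "\<And>t. t \<in> E \<Longrightarrow> kernel_gap \<Lambda> \<psi> \<omega> s m t"
proof -
  interpret prob_space \<nu> using ons by (simp add: orthonormal_system_def)
  let ?Q = "PiM {..<m} (\<lambda>_. \<nu>)"
  interpret Q: prob_space ?Q by (rule prob_space_PiM) (rule prob_space_axioms)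
  have \<psi> [measurable]: "\<psi> j \<in> borel_measurable \<nu>" if "j \<in> \<Lambda>" for j
    using ons that by (simp add: orthonormal_system_def)
  have sp: "space \<nu> = D" using ons by (simp add: orthonormal_system_def)
  let ?J = "\<Lambda> \<times> quarter_turns"
  define \<phi> where "\<phi> = (\<lambda>(j, c) u. Re (c * \<psi> j u) / \<omega> j)"
  have J: "finite ?J" using fin card_quarter_turns by simp
  \<comment> \<open>For \<open>N \<ge> 2\<close> the \<open>4 * N\<close> functions number at most
    \<open>N ^ 3\<close>, so the logarithm of their number is at most
    \<open>3 * ln N\<close>.\<close>
  have "2\<^sup>2 \<le> N\<^sup>2" using N(2) by (rule power_mono) simp
  then have "4 * N \<le> N\<^sup>2 * N" by (intro mult_right_mono) auto
  then have cardJ: "card ?J \<le> N ^ 3"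
    using N(1) card_quarter_turns by (simp add: card_cartesian_product power2_eq_square power3_eq_cube mult.commute)
  have \<phi>m: "\<phi> a \<in> borel_measurable \<nu>" if "a \<in> ?J" for a
    using that \<psi> by (auto simp: \<phi>_def intro!: borel_measurable_divide borel_measurable_const
        measurable_compose[OF _ borel_measurable_Re] borel_measurable_times)
  have \<phi>1: "\<bar>\<phi> a u\<bar> \<le> 1" if a: "a \<in> ?J" and u: "u \<in> space \<nu>" for a u
  proof -
    obtain j c where jc: "a = (j, c)" "j \<in> \<Lambda>" "c \<in> quarter_turns" using a by auto
    have "\<bar>Re (c * \<psi> j u)\<bar> \<le> norm (c * \<psi> j u)" by (rule abs_Re_le_cmod)
    also have "\<dots> \<le> \<omega> j" using bd[of j u] jc u sp by (simp add: norm_mult norm_quarter_turn)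
    finally show ?thesis using \<omega>[OF jc(2)] by (simp add: \<phi>_def jc(1))
  qed
  obtain B where B: "B \<in> sets ?Q" "measure ?Q B < real N powr (- ((ln s) ^ 3))"
    and Bt: "\<And>t \<kappa>. t \<in> space ?Q - B \<Longrightarrow> (\<And>a. a \<in> ?J \<Longrightarrow> 0 \<le> \<kappa> a) \<Longrightarrow>
       (\<Sum>a\<in>?J. \<kappa> a) = 1 \<Longrightarrow> 1 / (64 * s) \<le> (\<integral>u. (\<Sum>a\<in>?J. \<kappa> a * \<phi> a u)\<^sup>2 \<partial>\<nu>) \<Longrightarrow>
       \<exists>l<m. (\<Sum>a\<in>?J. \<kappa> a * \<phi> a (t l)) \<noteq> 0"
  proof (rule convex_combinations_not_vanishing[where J = ?J and \<phi> = \<phi> and N = N and s = s and m = m])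
    fix B
    assume B: "B \<in> sets ?Q" "measure ?Q B < real N powr (- ((ln s) ^ 3))"
      and Bt: "\<And>t \<kappa>. t \<in> space ?Q - B \<Longrightarrow> (\<And>a. a \<in> ?J \<Longrightarrow> 0 \<le> \<kappa> a) \<Longrightarrow>
       (\<Sum>a\<in>?J. \<kappa> a) = 1 \<Longrightarrow> 1 / (64 * s) \<le> (\<integral>u. (\<Sum>a\<in>?J. \<kappa> a * \<phi> a u)\<^sup>2 \<partial>\<nu>) \<Longrightarrow>
       \<exists>l<m. (\<Sum>a\<in>?J. \<kappa> a * \<phi> a (t l)) \<noteq> 0"
    show thesis by (rule that[OF B]) (rule Bt)
  qed (use J cardJ N \<phi>m \<phi>1 s m in auto)
  define W where "W v = (\<Sum>j\<in>\<Lambda>. \<omega> j * (\<bar>Re (v j)\<bar> + \<bar>Im (v j)\<bar>))" for v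
  have re: "(\<integral>u. (Re (expansion \<Lambda> \<psi> v u))\<^sup>2 \<partial>\<nu>) \<le> (W v)\<^sup>2 / (64 * s)"
    if t: "t \<in> space ?Q - B" and zero: "\<And>l. l < m \<Longrightarrow> expansion \<Lambda> \<psi> v (t l) = 0" for t v
  proof (cases "W v = 0")
    case True
    have "\<omega> j * (\<bar>Re (v j)\<bar> + \<bar>Im (v j)\<bar>) = 0" if "j \<in> \<Lambda>" for j
      using True that fin \<omega> unfolding W_def
      by (subst (asm) sum_nonneg_eq_0_iff) (auto intro!: mult_nonneg_nonneg dest: order_trans[OF zero_le_one])
    then have "v j = 0" if "j \<in> \<Lambda>" for j
      using \<omega>[OF that] that by (force simp: complex_eq_iff)
    then have "expansion \<Lambda> \<psi> v u = 0" for u by (simp add: expansion_def)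
    then show ?thesis using True by simp
  next
    case False
    have "0 \<le> W v" unfolding W_def using \<omega> by (intro sum_nonneg mult_nonneg_nonneg) (force intro: order_trans[OF zero_le_one])+
    with False have Wpos: "0 < W v" by simp
    \<comment> \<open>The factor \<open>\<omega> j\<close> cancels the division by
      \<open>\<omega> j\<close> in \<open>\<phi>\<close>; \<open>W v\<close> is the total mass
      before normalisation.\<close>
    define \<kappa> where "\<kappa> = (\<lambda>(j, c). \<omega> j * max 0 (Re (v j * cnj c)) / W v)"
    have \<kappa>0: "0 \<le> \<kappa> a" if "a \<in> ?J" for a
      using that \<omega> Wpos by (auto simp: \<kappa>_def intro!: divide_nonneg_pos mult_nonneg_nonneg dest: order_trans[OF zero_le_one])
    have "(\<Sum>a\<in>?J. \<kappa> a) = (\<Sum>j\<in>\<Lambda>. \<Sum>c\<in>quarter_turns. \<kappa> (j, c))" by (simp add: sum.cartesian_product)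
    also have "\<dots> = (\<Sum>j\<in>\<Lambda>. \<omega> j * (\<Sum>c\<in>quarter_turns. max 0 (Re (v j * cnj c))) / W v)"
      unfolding \<kappa>_def sum_distrib_left sum_divide_distrib by simp
    also have "\<dots> = 1"
      using False unfolding sum_quarter_turns_decomposition(2) sum_divide_distrib[symmetric] W_def[symmetric] by simp
    finally have \<kappa>1: "(\<Sum>a\<in>?J. \<kappa> a) = 1" .
    have h: "(\<Sum>a\<in>?J. \<kappa> a * \<phi> a u) = Re (expansion \<Lambda> \<psi> v u) / W v" for u
    proof -
      have "(\<Sum>a\<in>?J. \<kappa> a * \<phi> a u) = (\<Sum>j\<in>\<Lambda>. \<Sum>c\<in>quarter_turns. \<kappa> (j, c) * \<phi> (j, c) u)"
        by (simp add: sum.cartesian_product case_prod_unfold)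
      also have "\<dots> = (\<Sum>j\<in>\<Lambda>. (\<Sum>c\<in>quarter_turns. max 0 (Re (v j * cnj c)) * Re (c * \<psi> j u)) / W v)"
      proof (rule sum.cong[OF refl])
        fix j assume "j \<in> \<Lambda>"
        then have "\<omega> j \<noteq> 0" using \<omega>[of j] by auto
        then show "(\<Sum>c\<in>quarter_turns. \<kappa> (j, c) * \<phi> (j, c) u)
          = (\<Sum>c\<in>quarter_turns. max 0 (Re (v j * cnj c)) * Re (c * \<psi> j u)) / W v"
          unfolding sum_divide_distrib by (intro sum.cong refl) (simp add: \<kappa>_def \<phi>_def)
      qed
      also have "\<dots> = Re (expansion \<Lambda> \<psi> v u) / W v"
        unfolding sum_quarter_turns_decomposition(1) expansion_def Re_sum sum_divide_distrib ..
      finally show ?thesis .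
    qed
    have "\<not> (\<exists>l<m. (\<Sum>a\<in>?J. \<kappa> a * \<phi> a (t l)) \<noteq> 0)" unfolding h using zero by simp
    then have "\<not> 1 / (64 * s) \<le> (\<integral>u. (\<Sum>a\<in>?J. \<kappa> a * \<phi> a u)\<^sup>2 \<partial>\<nu>)"
      using Bt[OF t \<kappa>0 \<kappa>1] by blast
    then have "(\<integral>u. (Re (expansion \<Lambda> \<psi> v u))\<^sup>2 \<partial>\<nu>) / (W v)\<^sup>2 < 1 / (64 * s)"
      unfolding h power_divide by simp
    then show ?thesis using Wpos s by (simp add: field_simps)
  qed
  have "kernel_gap \<Lambda> \<psi> \<omega> s m t" if t: "t \<in> space ?Q - B" for t
    unfolding kernel_gap_def
  proof (intro allI impI)
    fix v assume zero: "\<forall>l<m. expansion \<Lambda> \<psi> v (t l) = 0"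
    let ?F = "expansion \<Lambda> \<psi> v"
    \<comment> \<open>Multiplication by \<open>- \<i>\<close> stays in the kernel and preserves
      \<open>W\<close>, while the real part becomes the imaginary part of the original
      expansion.\<close>
    have rot: "expansion \<Lambda> \<psi> (\<lambda>j. - \<i> * v j) u = - \<i> * ?F u" for u
      by (simp add: expansion_def sum_distrib_left mult.assoc sum_negf)
    have Fm [measurable]: "?F \<in> borel_measurable \<nu>"
      unfolding expansion_def by (intro borel_measurable_sum borel_measurable_times \<psi>) auto
    have Fb: "norm (?F u) \<le> wnorm1 \<Lambda> \<omega> v" if "u \<in> space \<nu>" for u
      using that bd sp by (intro norm_expansion_le_wnorm1) auto
    have int: "integrable \<nu> (\<lambda>u. (Re (?F u))\<^sup>2)" "integrable \<nu> (\<lambda>u. (Im (?F u))\<^sup>2)"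
      by (rule integrable_const_bound[where B = "(wnorm1 \<Lambda> \<omega> v)\<^sup>2"],
          auto intro!: AE_I2 abs_le_square_iff[THEN iffD1] order_trans[OF abs_Re_le_cmod] order_trans[OF abs_Im_le_cmod]
            intro: order_trans[OF Fb abs_ge_self])+
    have "(\<Sum>j\<in>\<Lambda>. (norm (v j))\<^sup>2) = (\<integral>u. (norm (?F u))\<^sup>2 \<partial>\<nu>)"
      using orthonormal_L2[OF ons fin bd] by simp
    also have "\<dots> = (\<integral>u. (Re (?F u))\<^sup>2 \<partial>\<nu>) + (\<integral>u. (Im (?F u))\<^sup>2 \<partial>\<nu>)"
      unfolding cmod_power2 by (rule Bochner_Integration.integral_add[OF int])
    also have "(\<integral>u. (Im (?F u))\<^sup>2 \<partial>\<nu>) = (\<integral>u. (Re (expansion \<Lambda> \<psi> (\<lambda>j. - \<i> * v j) u))\<^sup>2 \<partial>\<nu>)"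
      unfolding rot by simp
    also have "\<dots> \<le> (W (\<lambda>j. - \<i> * v j))\<^sup>2 / (64 * s)"
      using zero by (intro re[OF t]) (simp only: rot, simp)
    also have "W (\<lambda>j. - \<i> * v j) = W v" by (simp add: W_def add.commute)
    also have "(\<integral>u. (Re (?F u))\<^sup>2 \<partial>\<nu>) \<le> (W v)\<^sup>2 / (64 * s)"
      using zero by (intro re[OF t]) simp
    finally have le: "(\<Sum>j\<in>\<Lambda>. (norm (v j))\<^sup>2) \<le> (W v)\<^sup>2 / (32 * s)" by simp
    have W0: "0 \<le> W v" unfolding W_def using \<omega> by (intro sum_nonneg mult_nonneg_nonneg) (force intro: order_trans[OF zero_le_one])+
    \<comment> \<open>Passing to the modulus costs \<open>2\<close> in the square; with the two
      contributions of \<open>1 / (64 * s)\<close> this gives \<open>1 / (16 * s)\<close>, the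
      square of \<open>1 / (4 * sqrt s)\<close>.\<close>
    have "W v \<le> sqrt 2 * wnorm1 \<Lambda> \<omega> v"
      unfolding W_def wnorm1_def sum_distrib_left
    proof (rule sum_mono)
      fix j assume "j \<in> \<Lambda>"
      then have "\<omega> j * (\<bar>Re (v j)\<bar> + \<bar>Im (v j)\<bar>) \<le> \<omega> j * (sqrt 2 * norm (v j))"
        using \<omega>[of j] by (intro mult_left_mono complex_abs_le_norm) auto
      then show "\<omega> j * (\<bar>Re (v j)\<bar> + \<bar>Im (v j)\<bar>) \<le> sqrt 2 * (\<omega> j * norm (v j))"
        by (simp add: mult_ac)
    qed
    then have "(W v)\<^sup>2 \<le> (sqrt 2 * wnorm1 \<Lambda> \<omega> v)\<^sup>2" using W0 by (intro power_mono)
    also have "\<dots> = 2 * (wnorm1 \<Lambda> \<omega> v)\<^sup>2" by (simp add: power_mult_distrib)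
    finally have "(W v)\<^sup>2 / (32 * s) \<le> 2 * (wnorm1 \<Lambda> \<omega> v)\<^sup>2 / (32 * s)"
      using s by (intro divide_right_mono) auto
    with le have "16 * s * (\<Sum>j\<in>\<Lambda>. (norm (v j))\<^sup>2) \<le> (wnorm1 \<Lambda> \<omega> v)\<^sup>2"
      using s by (simp add: field_simps)
    then have "sqrt (16 * s * (\<Sum>j\<in>\<Lambda>. (norm (v j))\<^sup>2)) \<le> \<bar>wnorm1 \<Lambda> \<omega> v\<bar>"
      using real_sqrt_le_mono by fastforce
    moreover have "0 \<le> wnorm1 \<Lambda> \<omega> v"
      unfolding wnorm1_def using \<omega> by (intro sum_nonneg mult_nonneg_nonneg) (force intro: order_trans[OF zero_le_one])+
    ultimately show "4 * sqrt s * sqrt (\<Sum>j\<in>\<Lambda>. (norm (v j))\<^sup>2) \<le> wnorm1 \<Lambda> \<omega> v"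
      by (simp add: real_sqrt_mult)
  qed
  moreover have "1 - real N powr (- ((ln s) ^ 3)) < measure ?Q (space ?Q - B)"
    using B Q.prob_compl[OF B(1)] by simp
  ultimately show thesis using B(1) by (intro that[of "space ?Q - B"]) auto
qed

text \<open>With one function, \<open>ln N = 0\<close> makes the sampling condition void and the
  probability threshold is \<open>0\<close>, so positive probability suffices. The function has norm
  \<open>1\<close>, hence is nonzero on a set of positive measure; a sample hitting this set leaves
  only the zero coefficient in the kernel.\<close>

lemma kernel_gap_event_single:
  assumes ons: "orthonormal_system {j} \<psi> D \<nu>" and m: "1 \<le> m"
  obtains E where "E \<in> sets (PiM {..<m} (\<lambda>_. \<nu>))" "0 < measure (PiM {..<m} (\<lambda>_. \<nu>)) E"
    "\<And>t. t \<in> E \<Longrightarrow> kernel_gap {j} \<psi> \<omega> s m t"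
proof -
  interpret prob_space \<nu> using ons by (simp add: orthonormal_system_def)
  let ?Q = "PiM {..<m} (\<lambda>_. \<nu>)"
  interpret Q: prob_space ?Q by (rule prob_space_PiM) (rule prob_space_axioms)
  have \<psi> [measurable]: "\<psi> j \<in> borel_measurable \<nu>" and one: "(LINT u|\<nu>. \<psi> j u * cnj (\<psi> j u)) = 1"
    using ons by (simp_all add: orthonormal_system_def)
  define G where "G = {u \<in> space \<nu>. \<psi> j u \<noteq> 0}"
  have G [measurable]: "G \<in> sets \<nu>" unfolding G_def by measurable
  have "prob G \<noteq> 0"
  proof
    assume "prob G = 0"
    then have "AE u in \<nu>. u \<notin> G" using G by (simp add: prob_eq_0)
    then have "AE u in \<nu>. \<psi> j u * cnj (\<psi> j u) = 0"
      by (rule AE_mp) (auto simp: G_def intro!: AE_I2)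
    then have "(LINT u|\<nu>. \<psi> j u * cnj (\<psi> j u)) = 0" by (rule integral_eq_zero_AE)
    then show False using one by simp
  qed
  then have pos: "0 < prob G" using measure_nonneg[of \<nu> G] by linarith
  define B where "B = {t \<in> space ?Q. (\<Sum>l<m. indicator G (t l)) \<le> (0::real)}"
  have B: "B \<in> sets ?Q" unfolding B_def by measurable
  have "measure ?Q B \<le> exp (0 - real m * prob G / 2)"
    unfolding B_def by (rule few_samples_prob[OF G order_refl])
  also have "\<dots> < 1" using m pos by simp
  finally have meas: "0 < measure ?Q (space ?Q - B)" using Q.prob_compl[OF B] by simp
  show thesis
  proof (rule that[OF _ meas])
    show "space ?Q - B \<in> sets ?Q" using B by auto
    fix t assume "t \<in> space ?Q - B"
    then have "(\<Sum>l<m. indicator G (t l)) \<noteq> (0::real)" by (auto simp: B_def)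
    then obtain l where l: "l < m" "t l \<in> G"
      by (metis indicator_simps(2) lessThan_iff sum.neutral)
    show "kernel_gap {j} \<psi> \<omega> s m t"
      unfolding kernel_gap_def
    proof (intro allI impI)
      fix v assume "\<forall>l<m. expansion {j} \<psi> v (t l) = 0"
      then have "v j = 0" using l by (auto simp: expansion_def G_def)
      then show "4 * sqrt s * sqrt (\<Sum>i\<in>{j}. (norm (v i))\<^sup>2) \<le> wnorm1 {j} \<omega> v"
        by (simp add: wnorm1_def)
    qed
  qed
qed

section \<open>Assembly of the recovery theorem\<close>

theorem theorem1p1:
  shows "\<exists>c0 c1 d1 :: real. c0 > 0 \<and> c1 > 0 \<and> d1 > 0 \<and>
    (\<forall>(d :: nat) (D :: (nat \<Rightarrow> real) set) (\<nu> :: (nat \<Rightarrow> real) measure)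
      (\<Lambda> :: nat set) (\<psi> :: nat \<Rightarrow> (nat \<Rightarrow> real) \<Rightarrow> complex) (\<omega> :: nat \<Rightarrow> real)
      (s :: real) (N :: nat) (m :: nat).
      bounded_domain d D \<longrightarrow>
      finite \<Lambda> \<longrightarrow> \<Lambda> \<noteq> {} \<longrightarrow> card \<Lambda> = N \<longrightarrow>
      orthonormal_system \<Lambda> \<psi> D \<nu> \<longrightarrow>
      (\<forall>j\<in>\<Lambda>. \<omega> j \<ge> 1 \<and> sup_norm D (\<psi> j) \<le> ennreal (\<omega> j)) \<longrightarrow>
      s \<ge> 2 * (SUP j\<in>\<Lambda>. \<omega> j)\<^sup>2 \<longrightarrow>
      m \<ge> 1 \<longrightarrow>
      real m \<ge> c0 * s * (ln s) ^ 3 * ln (real N) \<longrightarrow>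
      (\<exists>E \<in> sets (PiM {..<m} (\<lambda>_. \<nu>)).
        measure (PiM {..<m} (\<lambda>_. \<nu>)) E > 1 - real N powr (- ((ln s) ^ 3)) \<and>
        (\<forall>t\<in>E. \<forall>x xs :: nat \<Rightarrow> complex.
          let f = expansion \<Lambda> \<psi> x;
              y = (\<lambda>l. f (t l));
              fs = expansion \<Lambda> \<psi> xs
          in wl1_solution \<Lambda> \<omega> m (sampling_matrix \<psi> t) y xs \<longrightarrow>
               sup_norm D (\<lambda>u. f u - fs u) \<le> ennreal (wnorm1 \<Lambda> \<omega> (\<lambda>j. x j - xs j)) \<and>
               wnorm1 \<Lambda> \<omega> (\<lambda>j. x j - xs j) \<le> c1 * best_approx_error \<Lambda> \<omega> s x \<and>
               L2_norm \<nu> (\<lambda>u. f u - fs u) \<le> d1 * best_approx_error \<Lambda> \<omega> s x / sqrt s)))"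
\<comment> \<open>\<open>10 ^ 11\<close> is the sampling constant of
  \<open>kernel_gap_event\<close>; \<open>4\<close> and \<open>1\<close> are the error constants of
  \<open>wl1_minimizer_error\<close>.\<close>
proof (rule exI[of _ "10 ^ 11"], rule exI[of _ 4], rule exI[of _ 1], intro conjI allI impI)
  fix d N m :: nat and D \<nu> and \<Lambda> :: "nat set" and \<psi> :: "nat \<Rightarrow> (nat \<Rightarrow> real) \<Rightarrow> complex"
    and \<omega> :: "nat \<Rightarrow> real" and s :: real
  assume fin: "finite \<Lambda>" and ne: "\<Lambda> \<noteq> {}" and N: "card \<Lambda> = N"
    and ons: "orthonormal_system \<Lambda> \<psi> D \<nu>"
    and \<omega>\<psi>: "\<forall>j\<in>\<Lambda>. \<omega> j \<ge> 1 \<and> sup_norm D (\<psi> j) \<le> ennreal (\<omega> j)"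
    and s: "s \<ge> 2 * (SUP j\<in>\<Lambda>. \<omega> j)\<^sup>2" and m1: "m \<ge> 1"
    and m: "real m \<ge> 10 ^ 11 * s * (ln s) ^ 3 * ln (real N)"
  have \<omega>: "1 \<le> \<omega> j" if "j \<in> \<Lambda>" for j using \<omega>\<psi> that by blast
  have bd: "norm (\<psi> j u) \<le> \<omega> j" if "j \<in> \<Lambda>" "u \<in> D" for j u
    using \<omega>\<psi> \<omega>[OF that(1)] that by (intro sup_norm_bound[of D]) auto
  obtain i where i: "i \<in> \<Lambda>" using ne by auto
  \<comment> \<open>Weights at least \<open>1\<close> turn the lower bound on \<open>s\<close> into
    \<open>s \<ge> 2\<close>, which keeps \<open>ln s\<close> away from \<open>0\<close>.\<close>
  have "1 \<le> (SUP j\<in>\<Lambda>. \<omega> j)"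
    using \<omega>[OF i] by (rule order_trans) (intro cSUP_upper i bdd_above_finite finite_imageI fin)
  then have "1\<^sup>2 \<le> (SUP j\<in>\<Lambda>. \<omega> j)\<^sup>2" by (intro power_mono) auto
  with s have s2: "2 \<le> s" by simp
  obtain E where E: "E \<in> sets (PiM {..<m} (\<lambda>_. \<nu>))"
    "1 - real N powr (- ((ln s) ^ 3)) < measure (PiM {..<m} (\<lambda>_. \<nu>)) E"
    "\<And>t. t \<in> E \<Longrightarrow> kernel_gap \<Lambda> \<psi> \<omega> s m t"
  proof (cases "2 \<le> N")
    case True
    show thesis by (rule kernel_gap_event[OF ons fin N True \<omega> bd s2 m]) (use that in auto)
  next
    case False
    then have N1: "N = 1" using N ne fin by (cases N) auto
    then obtain j where j: "\<Lambda> = {j}" using N card_1_singletonE by metis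
    show thesis
      using kernel_gap_event_single[OF ons[unfolded j] m1, of \<omega> s] that N1 unfolding j by auto
  qed
  \<comment> \<open>\<open>E\<close> was chosen through the kernel gap alone, so a single event
    serves all \<open>x\<close> and all minimisers \<open>xs\<close>.\<close>
  have "sup_norm D (\<lambda>u. expansion \<Lambda> \<psi> x u - expansion \<Lambda> \<psi> xs u) \<le> ennreal (wnorm1 \<Lambda> \<omega> (\<lambda>j. x j - xs j)) \<and>
      wnorm1 \<Lambda> \<omega> (\<lambda>j. x j - xs j) \<le> 4 * best_approx_error \<Lambda> \<omega> s x \<and>
      L2_norm \<nu> (\<lambda>u. expansion \<Lambda> \<psi> x u - expansion \<Lambda> \<psi> xs u) \<le> 1 * best_approx_error \<Lambda> \<omega> s x / sqrt s"
    if t: "t \<in> E"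
      and sol: "wl1_solution \<Lambda> \<omega> m (sampling_matrix \<psi> t) (\<lambda>l. expansion \<Lambda> \<psi> x (t l)) xs" for t x xs
  proof (intro conjI)
    have s0: "0 < s" using s2 by simp
    have \<omega>0: "0 \<le> \<omega> j" if "j \<in> \<Lambda>" for j using \<omega>[OF that] by simp
    note err = wl1_minimizer_error[OF fin \<omega>0 s0 E(3)[OF t] sol]
    show "wnorm1 \<Lambda> \<omega> (\<lambda>j. x j - xs j) \<le> 4 * best_approx_error \<Lambda> \<omega> s x" by (rule err(1))
    show "sup_norm D (\<lambda>u. expansion \<Lambda> \<psi> x u - expansion \<Lambda> \<psi> xs u) \<le> ennreal (wnorm1 \<Lambda> \<omega> (\<lambda>j. x j - xs j))"
      unfolding sup_norm_def expansion_diff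
      by (intro SUP_least ennreal_leI norm_expansion_le_wnorm1 bd)
    show "L2_norm \<nu> (\<lambda>u. expansion \<Lambda> \<psi> x u - expansion \<Lambda> \<psi> xs u) \<le> 1 * best_approx_error \<Lambda> \<omega> s x / sqrt s"
      using err(2) orthonormal_L2[OF ons fin bd, of "\<lambda>j. x j - xs j"]
      unfolding L2_norm_def expansion_diff by simp
  qed
  then show "\<exists>E \<in> sets (PiM {..<m} (\<lambda>_. \<nu>)).
        measure (PiM {..<m} (\<lambda>_. \<nu>)) E > 1 - real N powr (- ((ln s) ^ 3)) \<and>
        (\<forall>t\<in>E. \<forall>x xs :: nat \<Rightarrow> complex.
          let f = expansion \<Lambda> \<psi> x;
              y = (\<lambda>l. f (t l));
              fs = expansion \<Lambda> \<psi> xs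
          in wl1_solution \<Lambda> \<omega> m (sampling_matrix \<psi> t) y xs \<longrightarrow>
               sup_norm D (\<lambda>u. f u - fs u) \<le> ennreal (wnorm1 \<Lambda> \<omega> (\<lambda>j. x j - xs j)) \<and>
               wnorm1 \<Lambda> \<omega> (\<lambda>j. x j - xs j) \<le> 4 * best_approx_error \<Lambda> \<omega> s x \<and>
               L2_norm \<nu> (\<lambda>u. f u - fs u) \<le> 1 * best_approx_error \<Lambda> \<omega> s x / sqrt s)"
    using E(1,2) unfolding Let_def by (intro bexI[of _ E] conjI ballI allI impI) auto
qed simp_all

end
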